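(* For every $a\in\mathbb{R}$, $$\mathbb{P}\big(S(t)\le a\ \text{for all } t\in[0,1]\big)=\Phi(a)^2-a\,\phi(a)\Phi(a)-\phi(a)^2 .$$
   Context: $S(t)=B(t+1)-B(t)$, $t\in[0,1]$, where $B$ is a standard Brownian motion (the Slepian process). $\phi(x)=\frac{1}{\sqrt{2\pi}}e^{-x^2/2}$ is the standard normal density and $\Phi(x)=\int_{-\infty}^x\phi(s)\,ds$ the standard normal distribution function. *)

theory Defs
  imports "HOL-Probability.Probability"
begin

definition std_normal_cdf :: "real \<Rightarrow> real" where
  "std_normal_cdf x = (LBINT s:{..x}. std_normal_density s)"

definition std_brownian_motion :: "'a measure \<Rightarrow> (real \<Rightarrow> 'a \<Rightarrow> real) \<Rightarrow> bool" where
  "std_brownian_motion M B \<longleftrightarrow>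
     prob_space M \<and>
     (\<forall>t\<ge>0. B t \<in> borel_measurable M) \<and>
     (AE \<omega> in M. B 0 \<omega> = 0) \<and>
     (\<forall>\<omega>\<in>space M. continuous_on {0..} (\<lambda>t. B t \<omega>)) \<and>
     (\<forall>(n::nat) (t::nat \<Rightarrow> real). 0 \<le> t 0 \<and> (\<forall>i<n. t i \<le> t (Suc i)) \<longrightarrow>
        prob_space.indep_vars M (\<lambda>_. borel) (\<lambda>i \<omega>. B (t (Suc i)) \<omega> - B (t i) \<omega>) {..<n}) \<and>
     (\<forall>s t. 0 \<le> s \<and> s < t \<longrightarrow>
        distributed M lborel (\<lambda>\<omega>. B t \<omega> - B s \<omega>) (\<lambda>x. ennreal (normal_density 0 (sqrt (t - s)) x)))"

end

theory Submission
  imports Defs "HOL-Real_Asymp.Real_Asymp"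
begin

text \<open>
  Write \<open>W\<^sub>1(t) = B(t) - B(0)\<close> and \<open>W\<^sub>2(t) = B(1 + t) - B(1)\<close> for \<open>t \<in> [0,1]\<close>, and put
  \<open>U(t) = (W\<^sub>2(t) - W\<^sub>1(t)) / sqrt 2\<close> and \<open>V = (W\<^sub>1(1) + W\<^sub>2(1)) / sqrt 2\<close>. Then
  \<open>sqrt 2 * S(t) = 2 * U(t) - U(1) + V\<close>, so the event in question is \<open>R + V \<le> sqrt 2 * a\<close> with
  \<open>R = 2 * max U - U(1)\<close>.

  Reflecting \<open>U\<close> after its passage through a level \<open>m\<close> amounts to exchanging the later increments of
  \<open>W\<^sub>1\<close> and \<open>W\<^sub>2\<close>, an operation that preserves both the law of \<open>B\<close> and the value of \<open>V\<close>. Carried out on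
  a grid whose mesh tends to \<open>0\<close>, this yields the reflection principle
  \<open>P(max U > m, U(1) \<le> y, V \<in> A) = P(U(1) \<ge> 2 * m - y, V \<in> A)\<close>. Cutting the range of \<open>U(1)\<close> into thin slabs
  then shows that \<open>R\<close> is independent of \<open>V\<close> and has the Maxwell density \<open>2 * r\<^sup>2 * \<phi>(r)\<close>
  on \<open>r \<ge> 0\<close>. Since \<open>V\<close> is standard normal, the law of \<open>R + V\<close> is an explicit convolution.
\<close>

section \<open>The standard normal distribution\<close>

lemma std_normal_density_minus [simp]: "std_normal_density (- x) = std_normal_density x"
  by (simp add: std_normal_density_def)

lemma std_normal_density_times:
  "std_normal_density x * std_normal_density y = exp (- (x\<^sup>2 + y\<^sup>2) / 2) / (2 * pi)"
proof -
  have "exp (- (x\<^sup>2 + y\<^sup>2) / 2) = exp (- x\<^sup>2 / 2) * exp (- y\<^sup>2 / 2)"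
    by (simp add: exp_add[symmetric] add_divide_distrib)
  then show ?thesis
    by (simp add: std_normal_density_def)
qed

lemma DERIV_std_normal_density:
  "DERIV std_normal_density x :> - x * std_normal_density x"
  unfolding std_normal_density_def[abs_def]
  by (auto intro!: derivative_eq_intros simp: field_simps)

lemma emeasure_std_normal_distribution:
  "A \<in> sets borel \<Longrightarrow>
    emeasure std_normal_distribution A = (\<integral>\<^sup>+x. ennreal (std_normal_density x) * indicator A x \<partial>lborel)"
  by (simp add: emeasure_density)

lemma measure_std_normal_distribution_atMost:
  "measure std_normal_distribution {..x} = std_normal_cdf x"
proof -
  have "integrable lborel (\<lambda>s. indicator {..x} s * std_normal_density s)"
    using integrable_mult_indicator[of "{..x}" lborel std_normal_density] by simp
  then have "emeasure std_normal_distribution {..x} = ennreal (std_normal_cdf x)"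
    by (subst emeasure_std_normal_distribution)
       (auto simp: std_normal_cdf_def set_lebesgue_integral_def nn_integral_eq_integral[symmetric]
         intro!: nn_integral_cong split: split_indicator)
  moreover have "0 \<le> std_normal_cdf x"
    by (auto simp: std_normal_cdf_def set_lebesgue_integral_def)
  ultimately show ?thesis
    by (simp add: measure_def)
qed

lemma measure_std_normal_distribution_singleton [simp]:
  "measure std_normal_distribution {x} = 0"
proof -
  have "(\<integral>\<^sup>+y. ennreal (std_normal_density y) * indicator {x} y \<partial>lborel) = 0"
    using AE_lborel_singleton[of x]
    by (subst nn_integral_0_iff_AE) (auto elim!: eventually_mono)
  then show ?thesis
    by (simp add: measure_def emeasure_std_normal_distribution)
qed

interpretation std_normal: real_distribution std_normal_distribution
  by (rule real_dist_normal_dist)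

lemma std_normal_cdf_eq_cdf: "std_normal_cdf = cdf std_normal_distribution"
  by (simp add: fun_eq_iff cdf_def measure_std_normal_distribution_atMost)

lemma std_normal_cdf_at_top: "(std_normal_cdf \<longlongrightarrow> 1) at_top"
  unfolding std_normal_cdf_eq_cdf by (rule std_normal.cdf_lim_at_top_prob)

lemma measure_std_normal_distribution_greaterThanAtMost:
  assumes "x \<le> y"
  shows "measure std_normal_distribution {x<..y} = std_normal_cdf y - std_normal_cdf x"
proof (cases "x = y")
  case False
  with assms show ?thesis
    unfolding std_normal_cdf_eq_cdf by (intro std_normal.cdf_diff_eq[symmetric]) auto
qed simp

text \<open>Near \<open>x\<close> the distribution function is a constant plus an integral over the
  compact interval from \<open>x - 1\<close>, so the fundamental theorem of calculus for continuous
  integrands applies.\<close>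

lemma DERIV_std_normal_cdf: "DERIV std_normal_cdf x :> std_normal_density x"
proof -
  have cont: "continuous_on S std_normal_density" for S
    unfolding std_normal_density_def[abs_def] by (intro continuous_intros) auto
  have eq: "std_normal_cdf y = std_normal_cdf (x - 1) + integral {x - 1..y} std_normal_density"
    if "y \<in> {x - 1..x + 1}" for y
  proof -
    have "emeasure std_normal_distribution {x-1<..y} = (\<integral>\<^sup>+t. ennreal (std_normal_density t) * indicator {x-1..y} t \<partial>lborel)"
      unfolding emeasure_std_normal_distribution[of "{x-1<..y}", simplified]
      using AE_lborel_singleton[of "x - 1"]
      by (intro nn_integral_cong_AE) (auto split: split_indicator)
    also have "\<dots> = ennreal (integral {x - 1..y} std_normal_density)"
      using nn_integral_has_integral_lebesgue[OF _ integrable_integral[OF integrable_continuous_interval[OF cont, of "x - 1" y]]]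
      by (simp add: mult.commute ennreal_mult' ennreal_indicator nn_integral_completion)
    finally have "measure std_normal_distribution {x-1<..y} = integral {x - 1..y} std_normal_density"
      by (simp add: measure_def integral_nonneg integrable_continuous_interval[OF cont])
    then show ?thesis
      using that by (subst (asm) measure_std_normal_distribution_greaterThanAtMost) auto
  qed
  have "((\<lambda>y. std_normal_cdf (x - 1) + integral {x - 1..y} std_normal_density)
      has_real_derivative std_normal_density x) (at x within {x - 1..x + 1})"
    by (rule derivative_eq_intros integral_has_real_derivative[OF cont] | simp)+
  then have "(std_normal_cdf has_real_derivative std_normal_density x) (at x within {x - 1..x + 1})"
    by (rule has_field_derivative_transform_within[where d=1]) (auto simp flip: eq)
  then show ?thesis
    by (simp add: at_within_Icc_at)
qed

text \<open>The upper tail is computed here from the antiderivative and its limit 1 at infinity, and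
  in the next lemma by the substitution of \<open>- y\<close> for \<open>y\<close>. Comparing the
  two values gives \<open>std_normal_cdf_minus\<close>.\<close>

lemma measure_std_normal_distribution_atLeast:
  "measure std_normal_distribution {x..} = 1 - std_normal_cdf x"
proof -
  have "ennreal (measure std_normal_distribution {x..}) = ennreal (1 - std_normal_cdf x)"
    unfolding std_normal.emeasure_eq_measure[symmetric] emeasure_std_normal_distribution[of "{x..}", simplified]
    using DERIV_std_normal_cdf std_normal_cdf_at_top
    by (subst nn_integral_FTC_atLeast) auto
  then show ?thesis
    by (metis ennreal_inj diff_ge_0_iff_ge measure_nonneg measure_std_normal_distribution_atMost std_normal.prob_le_1)
qed

lemma measure_std_normal_distribution_atLeast_eq:
  "measure std_normal_distribution {x..} = std_normal_cdf (- x)"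
proof -
  have "emeasure std_normal_distribution {x..} = emeasure std_normal_distribution {..-x}"
    by (subst (1 2) emeasure_std_normal_distribution)
       (auto intro!: nn_integral_cong split: split_indicator simp: nn_integral_real_affine[where c="-1" and t=0 and f="\<lambda>y. ennreal (std_normal_density y) * indicator {x..} y"])
  then show ?thesis
    by (simp add: measure_def flip: measure_std_normal_distribution_atMost)
qed

lemma std_normal_cdf_minus: "std_normal_cdf (- x) = 1 - std_normal_cdf x"
  using measure_std_normal_distribution_atLeast measure_std_normal_distribution_atLeast_eq by metis

lemma std_normal_density_at_top: "(std_normal_density \<longlongrightarrow> 0) at_top"
  unfolding std_normal_density_def[abs_def] by real_asymp

lemma times_std_normal_density_at_top: "((\<lambda>x. x * std_normal_density x) \<longlongrightarrow> 0) at_top"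
  unfolding std_normal_density_def[abs_def] by real_asymp

section \<open>Rotations and permutations of independent variables\<close>

text \<open>The joint density of two independent standard normals depends only on
  \<open>x^2 + y^2\<close>, so a rotation by 45 degrees yields independent standard normals again.
  The planar change of variables is done as two one-dimensional substitutions with an exchange of
  integrals between them.\<close>

lemma (in prob_space) prob_rotated_std_normal:
  assumes indep: "indep_var borel X borel Y"
    and X: "distributed M lborel X std_normal_density"
    and Y: "distributed M lborel Y std_normal_density"
    and [measurable]: "I \<in> sets borel" "A \<in> sets borel"
  shows "prob {\<omega> \<in> space M. (Y \<omega> - X \<omega>) / sqrt 2 \<in> I \<and> (X \<omega> + Y \<omega>) / sqrt 2 \<in> A} =
    measure std_normal_distribution I * measure std_normal_distribution A"
proof -
  let ?\<phi> = "\<lambda>x. ennreal (std_normal_density x)"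
  let ?E = "{p \<in> space (borel \<Otimes>\<^sub>M borel). (snd p - fst p) / sqrt 2 \<in> I \<and> (fst p + snd p) / sqrt 2 \<in> A} :: (real \<times> real) set"
  have [measurable]: "X \<in> borel_measurable M" "Y \<in> borel_measurable M"
    using indep_var_rv1[OF indep] indep_var_rv2[OF indep] by auto
  have "distr M borel X = std_normal_distribution" "distr M borel Y = std_normal_distribution"
    using distributed_distr_eq_density[OF X] distributed_distr_eq_density[OF Y]
    by (simp_all cong: distr_cong)
  then have law: "distr M (borel \<Otimes>\<^sub>M borel) (\<lambda>\<omega>. (X \<omega>, Y \<omega>)) = std_normal_distribution \<Otimes>\<^sub>M std_normal_distribution"
    using indep by (simp add: indep_var_distribution_eq)
  have E: "?E \<in> sets (borel \<Otimes>\<^sub>M borel)"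
    by measurable
  have s2: "sqrt 2 * sqrt 2 = (2::real)" by simp
  have ind: "(\<lambda>x. indicator B (f x) :: ennreal) \<in> borel_measurable N"
    if "f \<in> borel_measurable N" "B \<in> sets borel" for f :: "'c \<Rightarrow> real" and B and N :: "'c measure"
    using measurable_compose[OF that(1) borel_measurable_indicator[OF that(2)]] .
  note [measurable] = ind
  have "emeasure M {\<omega> \<in> space M. (Y \<omega> - X \<omega>) / sqrt 2 \<in> I \<and> (X \<omega> + Y \<omega>) / sqrt 2 \<in> A} =
      emeasure (distr M (borel \<Otimes>\<^sub>M borel) (\<lambda>\<omega>. (X \<omega>, Y \<omega>))) ?E"
    using E by (subst emeasure_distr) (auto intro!: arg_cong[where f="emeasure M"] simp: space_pair_measure)
  also have "\<dots> = (\<integral>\<^sup>+x. \<integral>\<^sup>+y. indicator ?E (x, y) \<partial>std_normal_distribution \<partial>std_normal_distribution)"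
    unfolding law using E by (intro std_normal.emeasure_pair_measure)
      (simp cong: sets_pair_measure_cong)
  also have "\<dots> = (\<integral>\<^sup>+x. \<integral>\<^sup>+y. indicator I ((y - x) / sqrt 2) * indicator A ((x + y) / sqrt 2)
      \<partial>std_normal_distribution \<partial>std_normal_distribution)"
    by (intro nn_integral_cong) (auto split: split_indicator simp: space_pair_measure)
  also have "\<dots> = (\<integral>\<^sup>+x. \<integral>\<^sup>+y. ?\<phi> x * ?\<phi> y * (indicator I ((y - x) / sqrt 2) * indicator A ((x + y) / sqrt 2)) \<partial>lborel \<partial>lborel)"
    by (simp add: nn_integral_density nn_integral_cmult[symmetric] mult.assoc)
  \<comment> \<open>For fixed \<open>x\<close>, the variable \<open>y\<close> is replaced by
    \<open>v = (x + y) / sqrt 2\<close>, the second rotated coordinate.\<close>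
  also have "\<dots> = (\<integral>\<^sup>+x. ennreal (sqrt 2) * (\<integral>\<^sup>+v. ?\<phi> x * ?\<phi> (- x + sqrt 2 * v) *
      (indicator I (((- x + sqrt 2 * v) - x) / sqrt 2) * indicator A ((x + (- x + sqrt 2 * v)) / sqrt 2)) \<partial>lborel) \<partial>lborel)"
  proof (intro nn_integral_cong)
    fix x :: real
    show "(\<integral>\<^sup>+y. ?\<phi> x * ?\<phi> y * (indicator I ((y - x) / sqrt 2) * indicator A ((x + y) / sqrt 2)) \<partial>lborel) =
      ennreal (sqrt 2) * (\<integral>\<^sup>+v. ?\<phi> x * ?\<phi> (- x + sqrt 2 * v) *
        (indicator I (((- x + sqrt 2 * v) - x) / sqrt 2) * indicator A ((x + (- x + sqrt 2 * v)) / sqrt 2)) \<partial>lborel)"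
      by (subst nn_integral_real_affine[where c="sqrt 2" and t="- x"]) simp_all
  qed
  also have "\<dots> = (\<integral>\<^sup>+x. (\<integral>\<^sup>+v. ennreal (sqrt 2) * (?\<phi> x * ?\<phi> (- x + sqrt 2 * v) *
      (indicator I (v - sqrt 2 * x) * indicator A v)) \<partial>lborel) \<partial>lborel)"
  proof (intro nn_integral_cong, subst nn_integral_cmult[symmetric])
    fix x :: real
    have "((- x + sqrt 2 * v) - x) / sqrt 2 = v - sqrt 2 * x" for v
      using s2 by (simp add: field_simps)
    then show "(\<integral>\<^sup>+v. ennreal (sqrt 2) * (?\<phi> x * ?\<phi> (- x + sqrt 2 * v) *
      (indicator I (((- x + sqrt 2 * v) - x) / sqrt 2) * indicator A ((x + (- x + sqrt 2 * v)) / sqrt 2))) \<partial>lborel) =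
      (\<integral>\<^sup>+v. ennreal (sqrt 2) * (?\<phi> x * ?\<phi> (- x + sqrt 2 * v) * (indicator I (v - sqrt 2 * x) * indicator A v)) \<partial>lborel)"
      by (intro nn_integral_cong) simp
  qed simp
  also have "\<dots> = (\<integral>\<^sup>+v. (\<integral>\<^sup>+x. ennreal (sqrt 2) * (?\<phi> x * ?\<phi> (- x + sqrt 2 * v) *
      (indicator I (v - sqrt 2 * x) * indicator A v)) \<partial>lborel) \<partial>lborel)"
    by (rule lborel_pair.Fubini') simp
  \<comment> \<open>For fixed \<open>v\<close>, the variable \<open>x\<close> is replaced by
    \<open>u = v - sqrt 2 * x\<close>, the first rotated coordinate. Its factor
    \<open>1 / sqrt 2\<close> cancels the factor \<open>sqrt 2\<close> of the first
    substitution.\<close>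
  also have "\<dots> = (\<integral>\<^sup>+v. ennreal (1 / sqrt 2) * (\<integral>\<^sup>+u. ennreal (sqrt 2) * (?\<phi> (v / sqrt 2 + - (1 / sqrt 2) * u) *
      ?\<phi> (- (v / sqrt 2 + - (1 / sqrt 2) * u) + sqrt 2 * v) *
      (indicator I (v - sqrt 2 * (v / sqrt 2 + - (1 / sqrt 2) * u)) * indicator A v)) \<partial>lborel) \<partial>lborel)"
    by (intro nn_integral_cong nn_integral_real_affine[where c="- (1 / sqrt 2)", THEN trans]) simp_all
  also have "\<dots> = (\<integral>\<^sup>+v. (\<integral>\<^sup>+u. (?\<phi> v * indicator A v) * (?\<phi> u * indicator I u) \<partial>lborel) \<partial>lborel)"
  proof (intro nn_integral_cong, subst nn_integral_cmult[symmetric])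
    fix v :: real
    show "(\<integral>\<^sup>+u. ennreal (1 / sqrt 2) * (ennreal (sqrt 2) * (?\<phi> (v / sqrt 2 + - (1 / sqrt 2) * u) *
        ?\<phi> (- (v / sqrt 2 + - (1 / sqrt 2) * u) + sqrt 2 * v) *
        (indicator I (v - sqrt 2 * (v / sqrt 2 + - (1 / sqrt 2) * u)) * indicator A v))) \<partial>lborel) =
      (\<integral>\<^sup>+u. (?\<phi> v * indicator A v) * (?\<phi> u * indicator I u) \<partial>lborel)"
    proof (intro nn_integral_cong)
      fix u :: real
      have 1: "v - sqrt 2 * (v / sqrt 2 + - (1 / sqrt 2) * u) = u"
        by (simp add: field_simps)
      have 2: "- (v / sqrt 2 + - (1 / sqrt 2) * u) + sqrt 2 * v = (v + u) / sqrt 2"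
        using s2 by (simp add: field_simps)
      have 3: "v / sqrt 2 + - (1 / sqrt 2) * u = (v - u) / sqrt 2"
        by (simp add: field_simps)
      have "std_normal_density ((v - u) / sqrt 2) * std_normal_density ((v + u) / sqrt 2) =
          std_normal_density v * std_normal_density u"
        by (simp add: std_normal_density_def power_divide field_simps power2_eq_square flip: exp_add)
      then have 4: "?\<phi> ((v - u) / sqrt 2) * ?\<phi> ((v + u) / sqrt 2) = ?\<phi> v * ?\<phi> u"
        by (simp flip: ennreal_mult)
      have 5: "ennreal (1 / sqrt 2) * (ennreal (sqrt 2) * c) = c" for c
        by (simp add: mult.assoc[symmetric] flip: ennreal_mult)
      show "ennreal (1 / sqrt 2) * (ennreal (sqrt 2) * (?\<phi> (v / sqrt 2 + - (1 / sqrt 2) * u) *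
        ?\<phi> (- (v / sqrt 2 + - (1 / sqrt 2) * u) + sqrt 2 * v) *
        (indicator I (v - sqrt 2 * (v / sqrt 2 + - (1 / sqrt 2) * u)) * indicator A v))) =
        (?\<phi> v * indicator A v) * (?\<phi> u * indicator I u)"
        unfolding 1 2 unfolding 3 4 5 by (simp add: ac_simps)
    qed
  qed simp
  also have "\<dots> = emeasure std_normal_distribution A * emeasure std_normal_distribution I"
    by (simp add: emeasure_std_normal_distribution nn_integral_cmult nn_integral_multc)
  finally show ?thesis
    by (simp add: measure_def enn2real_mult mult.commute)
qed

text \<open>The joint law of an iid family is a power of a single measure, and an injection of the
  finite index set into itself only reindexes the factors.\<close>

lemma (in prob_space) prob_iid_permute:
  fixes D :: "'i \<Rightarrow> 'a \<Rightarrow> 'c::topological_space"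
  assumes indep: "indep_vars (\<lambda>_. borel) D I"
    and I: "I \<noteq> {}" "finite I"
    and law: "\<And>i. i \<in> I \<Longrightarrow> distr M borel (D i) = N"
    and \<pi>: "inj_on \<pi> I" "\<pi> \<in> I \<rightarrow> I"
    and E: "E \<in> sets (Pi\<^sub>M I (\<lambda>_. borel))"
  shows "prob {\<omega> \<in> space M. (\<lambda>i\<in>I. D (\<pi> i) \<omega>) \<in> E} = prob {\<omega> \<in> space M. (\<lambda>i\<in>I. D i \<omega>) \<in> E}"
proof -
  let ?P = "Pi\<^sub>M I (\<lambda>_. borel :: 'c measure)"
  have rv: "\<And>i. i \<in> I \<Longrightarrow> D i \<in> borel_measurable M"
    using indep by (auto simp: indep_vars_def)
  then have D: "(\<lambda>\<omega>. \<lambda>i\<in>I. D i \<omega>) \<in> measurable M ?P"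
    by (intro measurable_restrict)
  have N: "prob_space N" "sets N = sets borel"
    using I law rv by (metis all_not_in_conv prob_space_distr, metis all_not_in_conv sets_distr)
  have g: "(\<lambda>\<omega>. \<lambda>i\<in>I. \<omega> (\<pi> i)) \<in> measurable ?P ?P"
    using \<pi> by (intro measurable_restrict measurable_component_singleton) auto
  have *: "distr M ?P (\<lambda>\<omega>. \<lambda>i\<in>I. D i \<omega>) = Pi\<^sub>M I (\<lambda>_. N)"
    using indep rv I law by (subst (asm) indep_vars_iff_distr_eq_PiM') (auto cong: PiM_cong)
  have "distr M ?P (\<lambda>\<omega>. \<lambda>i\<in>I. D (\<pi> i) \<omega>) = distr M ?P ((\<lambda>\<omega>. \<lambda>i\<in>I. \<omega> (\<pi> i)) \<circ> (\<lambda>\<omega>. \<lambda>i\<in>I. D i \<omega>))"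
    using \<pi> by (intro distr_cong) (auto simp: fun_eq_iff)
  also have "\<dots> = distr (Pi\<^sub>M I (\<lambda>_. N)) ?P (\<lambda>\<omega>. \<lambda>i\<in>I. \<omega> (\<pi> i))"
    unfolding *[symmetric] using g D by (subst distr_distr) auto
  also have "\<dots> = distr (Pi\<^sub>M I (\<lambda>_. N)) (Pi\<^sub>M I (\<lambda>_. N)) (\<lambda>\<omega>. \<lambda>i\<in>I. \<omega> (\<pi> i))"
    using N by (intro distr_cong) (auto cong: sets_PiM_cong)
  also have "\<dots> = Pi\<^sub>M I (\<lambda>_. N)"
    using N \<pi> by (intro distr_PiM_reindex[where M="\<lambda>_. N"]) auto
  finally have eq: "distr M ?P (\<lambda>\<omega>. \<lambda>i\<in>I. D (\<pi> i) \<omega>) = distr M ?P (\<lambda>\<omega>. \<lambda>i\<in>I. D i \<omega>)"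
    by (simp add: *)
  have D\<pi>: "(\<lambda>\<omega>. \<lambda>i\<in>I. D (\<pi> i) \<omega>) \<in> measurable M ?P"
    using \<pi> by (intro measurable_restrict rv) auto
  show ?thesis
    using arg_cong[OF eq, of "\<lambda>P. measure P E"] E
    by (simp add: measure_distr[OF D] measure_distr[OF D\<pi>] vimage_def Int_def conj_commute)
qed

section \<open>The reflection principle on a grid\<close>

text \<open>Here \<open>k\<close> is a fixed index of first passage above \<open>m\<close>.
  Exchanging \<open>D i\<close> and \<open>D (N + i)\<close> for \<open>k <= i < N\<close> keeps the
  partial sums up to \<open>k\<close>, hence the passage event, and keeps \<open>V\<close>; it
  negates the later increments of \<open>S\<close>, so \<open>S N\<close> becomes
  \<open>2 * S k - S N\<close>. The exchange is a permutation of an iid family, so probabilities do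
  not change.\<close>

lemma (in prob_space) prob_reflect_discrete:
  fixes D :: "nat \<Rightarrow> 'a \<Rightarrow> real" and N :: nat and m y :: real
  defines "S \<equiv> \<lambda>k \<omega>. \<Sum>i<k. (D (N + i) \<omega> - D i \<omega>) / sqrt 2"
    and "V \<equiv> \<lambda>\<omega>. \<Sum>i<N. (D (N + i) \<omega> + D i \<omega>) / sqrt 2"
  assumes indep: "indep_vars (\<lambda>_. borel) D {..<2 * N}"
    and law: "\<And>i. i < 2 * N \<Longrightarrow> distr M borel (D i) = L"
    and k: "k \<le> N" and A[measurable]: "A \<in> sets borel"
  shows "prob {\<omega> \<in> space M. (m < S k \<omega> \<and> (\<forall>j<k. S j \<omega> \<le> m)) \<and> S N \<omega> \<le> y \<and> V \<omega> \<in> A} =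
    prob {\<omega> \<in> space M. (m < S k \<omega> \<and> (\<forall>j<k. S j \<omega> \<le> m)) \<and> 2 * S k \<omega> - S N \<omega> \<le> y \<and> V \<omega> \<in> A}"
\<comment> \<open>\<open>prob_iid_permute\<close> asks for a nonempty index set; for
  \<open>N = 0\<close> both events coincide because all sums are empty.\<close>
proof (cases "N = 0")
  case True
  with k show ?thesis by (simp add: S_def)
next
  case False
  define I where "I = {..<2 * N}"
  define s where "s = (\<lambda>k (\<delta>::nat \<Rightarrow> real). \<Sum>i<k. (\<delta> (N + i) - \<delta> i) / sqrt 2)"
  define v where "v = (\<lambda>\<delta>::nat \<Rightarrow> real. \<Sum>i<N. (\<delta> (N + i) + \<delta> i) / sqrt 2)"
  \<comment> \<open>Exchanging \<open>D i\<close> and \<open>D (N + i)\<close> flips the sign of the \<open>i\<close>-th increment of \<open>S\<close> and fixes that of \<open>V\<close>.\<close>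
  define \<pi> where "\<pi> = (\<lambda>i. if k \<le> i \<and> i < N then N + i else if N + k \<le> i \<and> i < 2 * N then i - N else i)"
  let ?P = "Pi\<^sub>M I (\<lambda>_. borel :: real measure)"
  have comp: "(\<lambda>\<delta>. \<delta> i) \<in> borel_measurable ?P" if "i < 2 * N" for i
    using that by (intro measurable_component_singleton) (simp add: I_def)
  have s[measurable]: "s j \<in> borel_measurable ?P" if "j \<le> N" for j
    unfolding s_def using that
    by (intro borel_measurable_sum borel_measurable_divide borel_measurable_diff comp) auto
  have v[measurable]: "v \<in> borel_measurable ?P"
    unfolding v_def
    by (intro borel_measurable_sum borel_measurable_divide borel_measurable_add comp) auto
  \<comment> \<open>The quantifier ranges over the set \<open>{..<k}\<close> so that the
    measurability prover treats it as a countable intersection; the same device recurs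
    below.\<close>
  let ?E = "{\<delta> \<in> space ?P. (m < s k \<delta> \<and> (\<forall>j\<in>{..<k}. s j \<delta> \<le> m)) \<and> s N \<delta> \<le> y \<and> v \<delta> \<in> A}"
  have [measurable]: "s k \<in> borel_measurable ?P" "s N \<in> borel_measurable ?P"
    "j \<in> {..<k} \<Longrightarrow> s j \<in> borel_measurable ?P" for j
    using k by auto
  have E: "?E \<in> sets ?P"
    by measurable
  have "prob {\<omega> \<in> space M. (\<lambda>i\<in>I. D (\<pi> i) \<omega>) \<in> ?E} = prob {\<omega> \<in> space M. (\<lambda>i\<in>I. D i \<omega>) \<in> ?E}"
  proof (rule prob_iid_permute[OF _ _ _ _ _ _ E])
    show "inj_on \<pi> I"
      by (auto simp: inj_on_def \<pi>_def I_def split: if_splits)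
    show "\<pi> \<in> I \<rightarrow> I"
      by (auto simp: \<pi>_def I_def)
  qed (use False indep law in \<open>auto simp: I_def lessThan_empty_iff\<close>)
  moreover have "s j (\<lambda>i\<in>I. D i \<omega>) = S j \<omega>" if "j \<le> N" for j \<omega>
    using that by (auto simp: s_def S_def I_def intro!: sum.cong)
  moreover have "v (\<lambda>i\<in>I. D i \<omega>) = V \<omega>" for \<omega>
    by (auto simp: v_def V_def I_def intro!: sum.cong)
  moreover have swap_s: "s j (\<lambda>i\<in>I. D (\<pi> i) \<omega>) = S j \<omega>" if "j \<le> k" for j \<omega>
    using that k by (auto simp: s_def S_def I_def \<pi>_def intro!: sum.cong)
  moreover have "v (\<lambda>i\<in>I. D (\<pi> i) \<omega>) = V \<omega>" for \<omega>
    by (auto simp: v_def V_def I_def \<pi>_def intro!: sum.cong)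
  moreover have "s N (\<lambda>i\<in>I. D (\<pi> i) \<omega>) = 2 * S k \<omega> - S N \<omega>" for \<omega>
  proof -
    have split: "(\<Sum>i<N. f i) = (\<Sum>i<k. f i) + (\<Sum>i\<in>{k..<N}. f i)" for f :: "nat \<Rightarrow> real"
      using k by (subst sum.union_disjoint[symmetric]) (auto intro!: sum.cong)
    have "s N (\<lambda>i\<in>I. D (\<pi> i) \<omega>) = s k (\<lambda>i\<in>I. D (\<pi> i) \<omega>) + (\<Sum>i\<in>{k..<N}. - ((D (N + i) \<omega> - D i \<omega>) / sqrt 2))"
      unfolding s_def split
      by (intro arg_cong2[where f="(+)"] sum.cong) (auto simp: I_def \<pi>_def field_simps)
    also have "\<dots> = S k \<omega> - (S N \<omega> - S k \<omega>)"
      unfolding swap_s[OF order.refl] by (simp add: S_def split sum_negf)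
    finally show ?thesis by simp
  qed
  moreover have "(\<lambda>i\<in>I. f i) \<in> space ?P" for f
    by (auto simp: space_PiM)
  ultimately show ?thesis
    using k by (simp add: Ball_def)
qed

text \<open>Summing the previous identity over the first passage index leaves the event
  \<open>2 * S k - S N \<le> y\<close>. Since \<open>S k\<close> exceeds \<open>m\<close>, it forces
  \<open>2 * m - y \<le> S N\<close>. Conversely, the overshoot \<open>S k - m\<close> is at most
  the last increment, hence at most \<open>\<epsilon>\<close> unless some increment is larger, and
  then \<open>2 * m - y + 2 * \<epsilon> \<le> S N\<close> suffices.\<close>

lemma (in prob_space) prob_reflect_discrete_bounds:
  fixes D :: "nat \<Rightarrow> 'a \<Rightarrow> real" and N :: nat and m y :: real
  defines "S \<equiv> \<lambda>k \<omega>. \<Sum>i<k. (D (N + i) \<omega> - D i \<omega>) / sqrt 2"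
    and "V \<equiv> \<lambda>\<omega>. \<Sum>i<N. (D (N + i) \<omega> + D i \<omega>) / sqrt 2"
  assumes indep: "indep_vars (\<lambda>_. borel) D {..<2 * N}"
    and law: "\<And>i. i < 2 * N \<Longrightarrow> distr M borel (D i) = L"
    and A[measurable]: "A \<in> sets borel"
    and "0 \<le> m" "y \<le> m"
  shows "prob {\<omega> \<in> space M. (\<exists>k\<le>N. m < S k \<omega>) \<and> S N \<omega> \<le> y \<and> V \<omega> \<in> A} \<le>
      prob {\<omega> \<in> space M. 2 * m - y \<le> S N \<omega> \<and> V \<omega> \<in> A}"
    and "0 < \<epsilon> \<Longrightarrow> prob {\<omega> \<in> space M. 2 * m - y + 2 * \<epsilon> \<le> S N \<omega> \<and> V \<omega> \<in> A}
        - prob {\<omega> \<in> space M. \<exists>k<N. \<epsilon> < S (Suc k) \<omega> - S k \<omega>}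
      \<le> prob {\<omega> \<in> space M. (\<exists>k\<le>N. m < S k \<omega>) \<and> S N \<omega> \<le> y \<and> V \<omega> \<in> A}"
proof -
  \<comment> \<open>\<open>T k\<close> says that \<open>k\<close> is the first passage index; these
    events are disjoint for different \<open>k\<close>.\<close>
  define T where "T = (\<lambda>k \<omega>. m < S k \<omega> \<and> (\<forall>j<k. S j \<omega> \<le> m))"
  have [measurable]: "D i \<in> borel_measurable M" if "i < 2 * N" for i
    using indep that by (auto simp: indep_vars_def)
  have S: "S k \<in> borel_measurable M" if "k \<le> N" for k
    unfolding S_def using that
    by (intro borel_measurable_sum borel_measurable_divide borel_measurable_diff) auto
  have [measurable]: "V \<in> borel_measurable M"
    unfolding V_def by (intro borel_measurable_sum borel_measurable_divide borel_measurable_add) auto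
  have [measurable]: "S N \<in> borel_measurable M" "k \<in> {..N} \<Longrightarrow> S k \<in> borel_measurable M"
    "k \<in> {..<N} \<Longrightarrow> S k \<in> borel_measurable M" "k \<in> {..<N} \<Longrightarrow> S (Suc k) \<in> borel_measurable M" for k
    by (auto intro: S)
  have T_unique: "k = k'" if "T k \<omega>" "T k' \<omega>" for k k' \<omega>
    using that unfolding T_def by (metis leD linorder_neqE_nat)
  have T_ex: "(\<exists>k\<le>N. m < S k \<omega>) \<longleftrightarrow> (\<exists>k\<le>N. T k \<omega>)" for \<omega>
  proof
    assume "\<exists>k\<le>N. m < S k \<omega>"
    then obtain k where k: "k \<le> N" "m < S k \<omega>" by auto
    define j where "j = (LEAST j. m < S j \<omega>)"
    have "m < S j \<omega>" "j \<le> k" "\<forall>i<j. \<not> m < S i \<omega>"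
      unfolding j_def using k by (auto intro: LeastI Least_le dest: not_less_Least)
    with k show "\<exists>k\<le>N. T k \<omega>"
      by (intro exI[of _ j]) (auto simp: T_def not_less)
  qed (auto simp: T_def)
  have T_meas[measurable]: "Measurable.pred M (T k)" if "k \<in> {..N}" for k
  proof -
    have [measurable]: "S k \<in> borel_measurable M" "j \<in> {..<k} \<Longrightarrow> S j \<in> borel_measurable M" for j
      using that by (auto intro: S)
    have "T k = (\<lambda>\<omega>. m < S k \<omega> \<and> (\<forall>j\<in>{..<k}. S j \<omega> \<le> m))"
      by (auto simp: T_def fun_eq_iff)
    then show ?thesis by simp
  qed
  let ?R = "\<lambda>k. {\<omega> \<in> space M. T k \<omega> \<and> 2 * S k \<omega> - S N \<omega> \<le> y \<and> V \<omega> \<in> A}"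
  have R_sets: "?R k \<in> events" if "k \<le> N" for k
  proof -
    have [measurable]: "S k \<in> borel_measurable M" "Measurable.pred M (T k)"
      using that by (auto intro: S T_meas)
    show ?thesis by measurable
  qed
  have L_sets: "{\<omega> \<in> space M. T k \<omega> \<and> S N \<omega> \<le> y \<and> V \<omega> \<in> A} \<in> events" if "k \<le> N" for k
  proof -
    have [measurable]: "Measurable.pred M (T k)"
      using that by (auto intro: T_meas)
    show ?thesis by measurable
  qed
  have "prob {\<omega> \<in> space M. (\<exists>k\<le>N. m < S k \<omega>) \<and> S N \<omega> \<le> y \<and> V \<omega> \<in> A} =
      prob (\<Union>k\<in>{..N}. {\<omega> \<in> space M. T k \<omega> \<and> S N \<omega> \<le> y \<and> V \<omega> \<in> A})"
    unfolding T_ex by (intro arg_cong[where f=prob]) auto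
  also have "\<dots> = (\<Sum>k\<in>{..N}. prob {\<omega> \<in> space M. T k \<omega> \<and> S N \<omega> \<le> y \<and> V \<omega> \<in> A})"
    using L_sets T_unique
    by (intro finite_measure_finite_Union) (auto simp: disjoint_family_on_def)
  also have "\<dots> = (\<Sum>k\<in>{..N}. prob (?R k))"
    unfolding T_def S_def V_def
    by (intro sum.cong prob_reflect_discrete[OF indep law _ A]) auto
  also have "\<dots> = prob (\<Union>k\<in>{..N}. ?R k)"
    using R_sets T_unique
    by (intro finite_measure_finite_Union[symmetric]) (auto simp: disjoint_family_on_def)
  finally have eq: "prob {\<omega> \<in> space M. (\<exists>k\<le>N. m < S k \<omega>) \<and> S N \<omega> \<le> y \<and> V \<omega> \<in> A} = prob (\<Union>k\<in>{..N}. ?R k)" .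

  show "prob {\<omega> \<in> space M. (\<exists>k\<le>N. m < S k \<omega>) \<and> S N \<omega> \<le> y \<and> V \<omega> \<in> A} \<le>
      prob {\<omega> \<in> space M. 2 * m - y \<le> S N \<omega> \<and> V \<omega> \<in> A}"
    unfolding eq by (intro finite_measure_mono) (auto simp: T_def)

  assume "0 < \<epsilon>"
  let ?J = "{\<omega> \<in> space M. \<exists>k<N. \<epsilon> < S (Suc k) \<omega> - S k \<omega>}"
  have J: "?J = {\<omega> \<in> space M. \<exists>k\<in>{..<N}. \<epsilon> < S (Suc k) \<omega> - S k \<omega>}"
    by auto
  have J_sets: "?J \<in> events"
    unfolding J by measurable
  have "{\<omega> \<in> space M. 2 * m - y + 2 * \<epsilon> \<le> S N \<omega> \<and> V \<omega> \<in> A} \<subseteq> (\<Union>k\<in>{..N}. ?R k) \<union> ?J"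
  proof safe
    fix \<omega> assume \<omega>: "\<omega> \<in> space M" "2 * m - y + 2 * \<epsilon> \<le> S N \<omega>" "V \<omega> \<in> A"
      and nR: "\<omega> \<notin> (\<Union>k\<in>{..N}. ?R k)"
    have "m < S N \<omega>"
      using \<omega> \<open>y \<le> m\<close> \<open>0 < \<epsilon>\<close> by simp
    then obtain k where k: "k \<le> N" "T k \<omega>"
      using T_ex by blast
    \<comment> \<open>The walk starts at \<open>S 0 = 0 \<le> m\<close>, so a predecessor of the
      passage index exists and bounds the overshoot.\<close>
    have "k \<noteq> 0"
      using k \<open>0 \<le> m\<close> by (intro notI) (simp add: T_def S_def)
    then obtain j where j: "k = Suc j" by (cases k) auto
    then have "S j \<omega> \<le> m"
      using k by (auto simp: T_def)
    moreover have "y < 2 * S k \<omega> - S N \<omega>"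
      using nR \<omega> k by (auto simp: not_le)
    ultimately show "\<exists>k<N. \<epsilon> < S (Suc k) \<omega> - S k \<omega>"
      using j k \<omega> by (intro exI[of _ j]) auto
  qed
  then have "prob {\<omega> \<in> space M. 2 * m - y + 2 * \<epsilon> \<le> S N \<omega> \<and> V \<omega> \<in> A} \<le> prob ((\<Union>k\<in>{..N}. ?R k) \<union> ?J)"
    using R_sets J_sets by (intro finite_measure_mono) auto
  also have "\<dots> \<le> prob (\<Union>k\<in>{..N}. ?R k) + prob ?J"
    using R_sets J_sets by (intro measure_Un_le) auto
  finally show "prob {\<omega> \<in> space M. 2 * m - y + 2 * \<epsilon> \<le> S N \<omega> \<and> V \<omega> \<in> A} - prob ?J
      \<le> prob {\<omega> \<in> space M. (\<exists>k\<le>N. m < S k \<omega>) \<and> S N \<omega> \<le> y \<and> V \<omega> \<in> A}"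
    unfolding eq by simp
qed

section \<open>The reflection principle in continuous time\<close>

lemma (in finite_measure) tendsto_measure_eventually:
  assumes [measurable]: "\<And>n. A n \<in> sets M" "B \<in> sets M"
    and ev: "\<And>\<omega>. \<omega> \<in> space M \<Longrightarrow> eventually (\<lambda>n. \<omega> \<in> A n \<longleftrightarrow> \<omega> \<in> B) sequentially"
  shows "(\<lambda>n. measure M (A n)) \<longlonglongrightarrow> measure M B"
proof -
  have "(\<lambda>n. \<integral>\<omega>. indicator (A n) \<omega> \<partial>M) \<longlonglongrightarrow> (\<integral>\<omega>. indicator B \<omega> \<partial>M :: real)"
  proof (rule integral_dominated_convergence[where w="\<lambda>_. 1"])
    show "AE \<omega> in M. (\<lambda>n. indicator (A n) \<omega> :: real) \<longlonglongrightarrow> indicator B \<omega>"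
    proof (intro AE_I2 tendsto_eventually)
      fix \<omega> assume "\<omega> \<in> space M"
      from ev[OF this] show "\<forall>\<^sub>F n in sequentially. (indicator (A n) \<omega> :: real) = indicator B \<omega>"
        by eventually_elim (auto simp: indicator_def)
    qed
  qed (auto simp: indicator_def)
  then show ?thesis
    by (simp add: Int_absorb2 sets.sets_into_space)
qed

text \<open>By continuity \<open>f\<close> stays above \<open>m\<close> near any point where it
  exceeds \<open>m\<close>, and a fine grid has a point that close. Conversely, every grid point
  lies in the unit interval.\<close>

lemma eventually_grid_exceeds_iff:
  fixes f :: "real \<Rightarrow> real"
  assumes f: "continuous_on {0..1} f"
  shows "\<forall>\<^sub>F N in sequentially. (\<exists>k\<le>N. m < f (real k / real N)) \<longleftrightarrow> (\<exists>t\<in>{0..1}. m < f t)"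
proof (cases "\<exists>t\<in>{0..1}. m < f t")
  case True
  then obtain t where t: "0 \<le> t" "t \<le> 1" "m < f t" by auto
  then obtain d where d: "0 < d" "\<And>s. s \<in> {0..1} \<Longrightarrow> dist s t < d \<Longrightarrow> dist (f s) (f t) < f t - m"
    using f unfolding continuous_on_iff by (metis atLeastAtMost_iff diff_gt_0_iff_gt)
  have "\<forall>\<^sub>F N in sequentially. inverse (real N) < d"
    using d(1) by (intro order_tendstoD[OF tendsto_inverse_0_at_top] filterlim_real_sequentially)
  then show ?thesis
    using eventually_gt_at_top[of "0::nat"]
  proof eventually_elim
    case (elim N)
    \<comment> \<open>The grid point \<open>k / N\<close> is the last one not beyond
      \<open>t\<close>, so it is within \<open>1 / N\<close> of \<open>t\<close>.\<close>
    define k where "k = nat \<lfloor>t * real N\<rfloor>"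
    have k: "real k \<le> t * real N" "t * real N < real k + 1"
      unfolding k_def using t by (auto simp: of_nat_nat floor_le_iff)
    have "t * real N \<le> 1 * real N"
      using t by (intro mult_right_mono) auto
    then have kN: "k \<le> N"
      using k by linarith
    moreover have "dist (real k / real N) t < d"
    proof -
      have "\<bar>real k / real N - t\<bar> \<le> inverse (real N)"
      proof -
        have "real k / real N \<le> t" "t \<le> real k / real N + inverse (real N)"
          using k elim by (auto simp: divide_le_eq inverse_eq_divide le_divide_eq simp flip: add_divide_distrib)
        then show ?thesis by (simp add: abs_le_iff)
      qed
      with elim show ?thesis by (simp add: dist_real_def)
    qed
    ultimately have "dist (f (real k / real N)) (f t) < f t - m"
      using elim by (intro d(2)) auto
    then have "m < f (real k / real N)"
      by (simp add: dist_real_def abs_less_iff)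
    with kN True show ?case by auto
  qed
next
  case False
  \<comment> \<open>This includes \<open>N = 0\<close>, where \<open>k = 0\<close> and division by
    zero gives 0.\<close>
  have "real k / real N \<in> {0..1}" if "k \<le> N" for k N :: nat
    using that by (auto simp: divide_le_eq)
  with False show ?thesis
    by (intro always_eventually) blast
qed

text \<open>Uniform continuity on the compact unit interval bounds all grid increments at once. This
  makes the overshoot term of the discrete bound vanish in the limit.\<close>

lemma eventually_grid_increments_le:
  fixes f :: "real \<Rightarrow> real"
  assumes f: "continuous_on {0..1} f" and "0 < e"
  shows "\<forall>\<^sub>F N in sequentially. \<not> (\<exists>k<N. e < f (real (Suc k) / real N) - f (real k / real N))"
proof -
  have "uniformly_continuous_on {0..1} f"
    using f by (rule compact_uniformly_continuous) simp
  then obtain d where d: "0 < d" "\<And>s t. s \<in> {0..1} \<Longrightarrow> t \<in> {0..1} \<Longrightarrow> dist s t < d \<Longrightarrow> dist (f s) (f t) < e"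
    using \<open>0 < e\<close> unfolding uniformly_continuous_on_def by metis
  have "\<forall>\<^sub>F N in sequentially. inverse (real N) < d"
    using d(1) by (intro order_tendstoD[OF tendsto_inverse_0_at_top] filterlim_real_sequentially)
  then show ?thesis
  proof eventually_elim
    case (elim N)
    have "f (real (Suc k) / real N) - f (real k / real N) < e" if "k < N" for k
    proof -
      have "dist (real (Suc k) / real N) (real k / real N) < d"
        using elim that by (simp add: dist_real_def field_simps)
      moreover have "real (Suc k) / real N \<in> {0..1}" "real k / real N \<in> {0..1}"
        using that by (auto simp: divide_le_eq)
      ultimately have "dist (f (real (Suc k) / real N)) (f (real k / real N)) < e"
        by (intro d(2))
      then show ?thesis by (simp add: dist_real_def)
    qed
    then show ?case by (auto simp: not_less intro: less_imp_le)
  qed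
qed

section \<open>The rotated process and its reflection principle\<close>

locale brownian_motion = prob_space M for M :: "'a measure" +
  fixes B :: "real \<Rightarrow> 'a \<Rightarrow> real"
  assumes bm: "std_brownian_motion M B"
begin

text \<open>\<open>B 0\<close> vanishes only almost surely; subtracting it makes \<open>U 0\<close>
  vanish at every outcome.\<close>

definition U :: "real \<Rightarrow> 'a \<Rightarrow> real" where
  "U t \<omega> = ((B (1 + t) \<omega> - B 1 \<omega>) - (B t \<omega> - B 0 \<omega>)) / sqrt 2"

text \<open>The two unit increments \<open>B 1 - B 0\<close> and \<open>B 2 - B 1\<close> telescope
  in their sum.\<close>

definition V :: "'a \<Rightarrow> real" where
  "V \<omega> = (B 2 \<omega> - B 0 \<omega>) / sqrt 2"

lemma B_measurable: "0 \<le> t \<Longrightarrow> B t \<in> borel_measurable M"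
  using bm by (auto simp: std_brownian_motion_def)

lemma U_measurable: "0 \<le> t \<Longrightarrow> U t \<in> borel_measurable M"
  unfolding U_def[abs_def]
  by (intro borel_measurable_divide borel_measurable_diff B_measurable borel_measurable_const) auto

lemma V_measurable [measurable]: "V \<in> borel_measurable M"
  unfolding V_def[abs_def]
  by (intro borel_measurable_divide borel_measurable_diff B_measurable borel_measurable_const) auto

lemma U_1_measurable [measurable]: "U 1 \<in> borel_measurable M"
  by (rule U_measurable) simp

lemma U_0 [simp]: "U 0 \<omega> = 0"
  by (simp add: U_def)

lemma continuous_on_U:
  assumes "\<omega> \<in> space M"
  shows "continuous_on {0..1} (\<lambda>t. U t \<omega>)"
proof -
  have B: "continuous_on {0..} (\<lambda>t. B t \<omega>)"
    using bm assms by (auto simp: std_brownian_motion_def)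
  have "continuous_on {0..1} (\<lambda>t. B (1 + t) \<omega>)"
    by (rule continuous_on_compose2[OF B]) (auto intro!: continuous_intros)
  moreover have "continuous_on {0..1} (\<lambda>t. B t \<omega>)"
    using B by (rule continuous_on_subset) auto
  ultimately show ?thesis
    unfolding U_def by (auto intro!: continuous_intros)
qed

text \<open>Path continuity replaces the uncountable union over times by a countable union over all
  grids.\<close>

lemma sets_U_exceeds [measurable]: "{\<omega> \<in> space M. \<exists>t\<in>{0..1}. m < U t \<omega>} \<in> sets M"
proof -
  have [measurable]: "U (real k / real N) \<in> borel_measurable M" for k N
    by (rule U_measurable) simp
  have "(\<exists>t\<in>{0..1}. m < U t \<omega>) \<longleftrightarrow> (\<exists>N::nat. \<exists>k\<in>{..N}. m < U (real k / real N) \<omega>)" if "\<omega> \<in> space M" for \<omega>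
  proof
    assume "\<exists>t\<in>{0..1}. m < U t \<omega>"
    with eventually_happens'[OF sequentially_bot eventually_grid_exceeds_iff[OF continuous_on_U[OF that], of m]]
    show "\<exists>N::nat. \<exists>k\<in>{..N}. m < U (real k / real N) \<omega>"
      unfolding Bex_def atMost_iff by blast
  next
    assume "\<exists>N::nat. \<exists>k\<in>{..N}. m < U (real k / real N) \<omega>"
    then obtain N k :: nat where "k \<le> N" "m < U (real k / real N) \<omega>" by auto
    then show "\<exists>t\<in>{0..1}. m < U t \<omega>"
      by (intro bexI[of _ "real k / real N"]) (auto simp: divide_le_eq)
  qed
  then have "{\<omega> \<in> space M. \<exists>t\<in>{0..1}. m < U t \<omega>} = {\<omega> \<in> space M. \<exists>N::nat. \<exists>k\<in>{..N}. m < U (real k / real N) \<omega>}"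
    by (intro Collect_cong conj_cong refl)
  also have "\<dots> \<in> sets M" by measurable
  finally show ?thesis .
qed

lemma indep_increments:
  "indep_vars (\<lambda>_. borel) (\<lambda>i \<omega>. B (real (Suc i) / real N) \<omega> - B (real i / real N) \<omega>) {..<n}"
proof -
  have "\<forall>(n::nat) (t::nat \<Rightarrow> real). 0 \<le> t 0 \<and> (\<forall>i<n. t i \<le> t (Suc i)) \<longrightarrow>
      indep_vars (\<lambda>_. borel) (\<lambda>i \<omega>. B (t (Suc i)) \<omega> - B (t i) \<omega>) {..<n}"
    using bm unfolding std_brownian_motion_def by (elim conjE)
  from this[rule_format, of "\<lambda>i. real i / real N" n] show ?thesis
    by (simp add: divide_right_mono)
qed

lemma distributed_increment:
  "0 \<le> s \<Longrightarrow> s < t \<Longrightarrow>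
    distributed M lborel (\<lambda>\<omega>. B t \<omega> - B s \<omega>) (\<lambda>x. ennreal (normal_density 0 (sqrt (t - s)) x))"
  using bm by (auto simp: std_brownian_motion_def)

text \<open>\<open>U 1\<close> and \<open>V\<close> are the rotated coordinates of the two
  independent standard normal increments of \<open>B\<close> over the first and the second unit
  interval.\<close>

lemma prob_U_V:
  assumes I: "I \<in> sets borel" and A: "A \<in> sets borel"
  shows "prob {\<omega> \<in> space M. U 1 \<omega> \<in> I \<and> V \<omega> \<in> A} =
    measure std_normal_distribution I * measure std_normal_distribution A"
proof -
  let ?D = "\<lambda>i \<omega>. B (real (Suc i)) \<omega> - B (real i) \<omega>"
  have "indep_vars (\<lambda>_. borel) ?D {..<2}"
    using indep_increments[of 1 2] by simp
  then have "indep_var (Pi\<^sub>M {0} (\<lambda>_. borel)) (\<lambda>\<omega>. \<lambda>i\<in>{0}. ?D i \<omega>) (Pi\<^sub>M {1} (\<lambda>_. borel)) (\<lambda>\<omega>. \<lambda>i\<in>{1}. ?D i \<omega>)"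
    by (rule indep_var_restrict) auto
  then have "indep_var borel ((\<lambda>f. f 0) \<circ> (\<lambda>\<omega>. \<lambda>i\<in>{0}. ?D i \<omega>)) borel ((\<lambda>f. f 1) \<circ> (\<lambda>\<omega>. \<lambda>i\<in>{1}. ?D i \<omega>))"
    by (rule indep_var_compose) (auto intro!: measurable_component_singleton)
  then have "indep_var borel (?D 0) borel (?D 1)"
    by (simp add: comp_def)
  from prob_rotated_std_normal[OF this _ _ I A]
  have "prob {\<omega> \<in> space M. (?D 1 \<omega> - ?D 0 \<omega>) / sqrt 2 \<in> I \<and> (?D 0 \<omega> + ?D 1 \<omega>) / sqrt 2 \<in> A} =
    measure std_normal_distribution I * measure std_normal_distribution A"
    using distributed_increment[of 0 1] distributed_increment[of 1 2] by simp
  then show ?thesis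
    by (simp add: U_def V_def numeral_2_eq_2)
qed

text \<open>The discrete bounds are applied on the grid of mesh \<open>1 / N\<close>. First
  \<open>N\<close> tends to infinity, where the grid event converges and large increments disappear;
  then \<open>\<epsilon>\<close> tends to 0 in the lower bound.\<close>

lemma prob_U_exceeds_reflected:
  assumes m: "0 \<le> m" "y \<le> m" and A[measurable]: "A \<in> sets borel"
  shows "prob {\<omega> \<in> space M. (\<exists>t\<in>{0..1}. m < U t \<omega>) \<and> U 1 \<omega> \<le> y \<and> V \<omega> \<in> A} =
    prob {\<omega> \<in> space M. 2 * m - y \<le> U 1 \<omega> \<and> V \<omega> \<in> A}"
    (is "prob ?E = _")
proof (rule antisym)
  let ?g = "\<lambda>N. prob {\<omega> \<in> space M. (\<exists>k\<le>N. m < U (real k / real N) \<omega>) \<and> U 1 \<omega> \<le> y \<and> V \<omega> \<in> A}"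
  let ?j = "\<lambda>\<epsilon> N. prob {\<omega> \<in> space M. \<exists>k<N. \<epsilon> < U (real (Suc k) / real N) \<omega> - U (real k / real N) \<omega>}"
  have [measurable]: "U (real k / real N) \<in> borel_measurable M" "U (real (Suc k) / real N) \<in> borel_measurable M" for k N
    by (rule U_measurable; simp)+
  have upper: "?g N \<le> prob {\<omega> \<in> space M. 2 * m - y \<le> U 1 \<omega> \<and> V \<omega> \<in> A}"
    and lower: "0 < \<epsilon> \<Longrightarrow> prob {\<omega> \<in> space M. 2 * m - y + 2 * \<epsilon> \<le> U 1 \<omega> \<and> V \<omega> \<in> A} - ?j \<epsilon> N \<le> ?g N"
    if "0 < N" for N \<epsilon>
  proof -
    \<comment> \<open>The first \<open>N\<close> of these are grid increments over the first unit
      interval, the next \<open>N\<close> over the second, so the sums in the discrete lemma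
      telescope to \<open>U\<close> at grid points and to \<open>V\<close>.\<close>
    define D where "D i \<omega> = B (real (Suc i) / real N) \<omega> - B (real i / real N) \<omega>" for i \<omega>
    have S: "(\<Sum>i<k. (D (N + i) \<omega> - D i \<omega>) / sqrt 2) = U (real k / real N) \<omega>" for k \<omega>
    proof -
      have "(\<Sum>i<k. (D (N + i) \<omega> - D i \<omega>) / sqrt 2) =
          (\<Sum>i<k. U (real (Suc i) / real N) \<omega> - U (real i / real N) \<omega>)"
        using that by (intro sum.cong refl) (simp add: D_def U_def add_divide_distrib diff_divide_distrib algebra_simps)
      also have "\<dots> = U (real k / real N) \<omega>"
        by (subst sum_lessThan_telescope) simp
      finally show ?thesis .
    qed
    have V: "(\<Sum>i<N. (D (N + i) \<omega> + D i \<omega>) / sqrt 2) = V \<omega>" for \<omega>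
    proof -
      let ?v = "\<lambda>i. (B (1 + real i / real N) \<omega> + B (real i / real N) \<omega>) / sqrt 2"
      have "(\<Sum>i<N. (D (N + i) \<omega> + D i \<omega>) / sqrt 2) = (\<Sum>i<N. ?v (Suc i) - ?v i)"
        using that by (intro sum.cong refl) (simp add: D_def add_divide_distrib diff_divide_distrib algebra_simps)
      also have "\<dots> = V \<omega>"
        using that by (subst sum_lessThan_telescope) (simp add: V_def field_simps)
      finally show ?thesis .
    qed
    have indep: "indep_vars (\<lambda>_. borel) D {..<2 * N}"
      using indep_increments[of N "2 * N"] by (simp add: D_def[abs_def])
    have law: "distr M borel (D i) = density lborel (normal_density 0 (sqrt (1 / real N)))" for i
    proof -
      have "real (Suc i) / real N - real i / real N = 1 / real N"
        by (simp add: add_divide_distrib)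
      moreover have "0 \<le> real i / real N" "real i / real N < real (Suc i) / real N"
        using that by (auto simp: divide_strict_right_mono)
      ultimately have "distributed M lborel (D i) (normal_density 0 (sqrt (1 / real N)))"
        using distributed_increment[of "real i / real N" "real (Suc i) / real N"] by (simp add: D_def[abs_def])
      from distributed_distr_eq_density[OF this] show ?thesis
        by (simp cong: distr_cong)
    qed
    note bounds = prob_reflect_discrete_bounds[OF indep law A m, unfolded S V]
    show "?g N \<le> prob {\<omega> \<in> space M. 2 * m - y \<le> U 1 \<omega> \<and> V \<omega> \<in> A}"
      using bounds(1) that by simp
    show "prob {\<omega> \<in> space M. 2 * m - y + 2 * \<epsilon> \<le> U 1 \<omega> \<and> V \<omega> \<in> A} - ?j \<epsilon> N \<le> ?g N" if "0 < \<epsilon>"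
      using bounds(2)[OF that] \<open>0 < N\<close> by simp
  qed

  have g: "?g \<longlonglongrightarrow> prob ?E"
  proof (rule tendsto_measure_eventually)
    fix \<omega> assume \<omega>: "\<omega> \<in> space M"
    from eventually_grid_exceeds_iff[OF continuous_on_U[OF \<omega>], of m]
    show "\<forall>\<^sub>F N in sequentially. (\<omega> \<in> {\<omega> \<in> space M. (\<exists>k\<le>N. m < U (real k / real N) \<omega>) \<and> U 1 \<omega> \<le> y \<and> V \<omega> \<in> A}) \<longleftrightarrow> \<omega> \<in> ?E"
      by eventually_elim (use \<omega> in auto)
  next
    fix N :: nat
    have "{\<omega> \<in> space M. (\<exists>k\<in>{..N}. m < U (real k / real N) \<omega>) \<and> U 1 \<omega> \<le> y \<and> V \<omega> \<in> A} \<in> events"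
      by measurable
    then show "{\<omega> \<in> space M. (\<exists>k\<le>N. m < U (real k / real N) \<omega>) \<and> U 1 \<omega> \<le> y \<and> V \<omega> \<in> A} \<in> events"
      by (simp only: Bex_def atMost_iff)
  qed measurable
  show "prob ?E \<le> prob {\<omega> \<in> space M. 2 * m - y \<le> U 1 \<omega> \<and> V \<omega> \<in> A}"
    using eventually_mono[OF eventually_gt_at_top[of "0::nat"] upper]
    by (intro tendsto_upperbound[OF g]) simp_all

  \<comment> \<open>This closed form shows that the lower bound is continuous in
    \<open>\<epsilon>\<close>, as the final limit requires.\<close>
  have N: "prob {\<omega> \<in> space M. c \<le> U 1 \<omega> \<and> V \<omega> \<in> A} = (1 - std_normal_cdf c) * measure std_normal_distribution A" for c
    using prob_U_V[of "{c..}" A] by (simp add: measure_std_normal_distribution_atLeast)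
  have "(1 - std_normal_cdf (2 * m - y + 2 * \<epsilon>)) * measure std_normal_distribution A \<le> prob ?E" if "0 < \<epsilon>" for \<epsilon>
  proof -
    have "?j \<epsilon> \<longlonglongrightarrow> prob {}"
    proof (rule tendsto_measure_eventually)
      fix \<omega> assume \<omega>: "\<omega> \<in> space M"
      from eventually_grid_increments_le[OF continuous_on_U[OF \<omega>] that]
      show "\<forall>\<^sub>F N in sequentially. (\<omega> \<in> {\<omega> \<in> space M. \<exists>k<N. \<epsilon> < U (real (Suc k) / real N) \<omega> - U (real k / real N) \<omega>}) \<longleftrightarrow> \<omega> \<in> {}"
        by eventually_elim auto
    next
      fix N :: nat
      have "{\<omega> \<in> space M. \<exists>k\<in>{..<N}. \<epsilon> < U (real (Suc k) / real N) \<omega> - U (real k / real N) \<omega>} \<in> events"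
        by measurable
      then show "{\<omega> \<in> space M. \<exists>k<N. \<epsilon> < U (real (Suc k) / real N) \<omega> - U (real k / real N) \<omega>} \<in> events"
        by (simp only: Bex_def lessThan_iff)
    qed measurable
    then have "(\<lambda>N. prob {\<omega> \<in> space M. 2 * m - y + 2 * \<epsilon> \<le> U 1 \<omega> \<and> V \<omega> \<in> A} - ?j \<epsilon> N)
        \<longlonglongrightarrow> prob {\<omega> \<in> space M. 2 * m - y + 2 * \<epsilon> \<le> U 1 \<omega> \<and> V \<omega> \<in> A} - prob {}"
      by (intro tendsto_intros)
    moreover have "\<forall>\<^sub>F N in sequentially. prob {\<omega> \<in> space M. 2 * m - y + 2 * \<epsilon> \<le> U 1 \<omega> \<and> V \<omega> \<in> A} - ?j \<epsilon> N \<le> ?g N"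
      using eventually_gt_at_top[of "0::nat"] by eventually_elim (rule lower[OF _ that])
    ultimately have "prob {\<omega> \<in> space M. 2 * m - y + 2 * \<epsilon> \<le> U 1 \<omega> \<and> V \<omega> \<in> A} - prob {} \<le> prob ?E"
      by (intro tendsto_le[OF _ g]) simp_all
    then show ?thesis
      unfolding N by simp
  qed
  then have "\<forall>\<^sub>F \<epsilon> in at_right 0. (1 - std_normal_cdf (2 * m - y + 2 * \<epsilon>)) * measure std_normal_distribution A \<le> prob ?E"
    by (auto simp: eventually_at_filter)
  moreover have "((\<lambda>\<epsilon>. (1 - std_normal_cdf (2 * m - y + 2 * \<epsilon>)) * measure std_normal_distribution A) \<longlongrightarrow>
      (1 - std_normal_cdf (2 * m - y + 2 * 0)) * measure std_normal_distribution A) (at_right 0)"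
    by (intro tendsto_intros isCont_tendsto_compose[OF DERIV_isCont[OF DERIV_std_normal_cdf]])
  ultimately show "prob {\<omega> \<in> space M. 2 * m - y \<le> U 1 \<omega> \<and> V \<omega> \<in> A} \<le> prob ?E"
    unfolding N by (intro tendsto_upperbound[where F="at_right (0::real)"]) auto
qed

end

section \<open>The law of twice the maximum minus the endpoint\<close>

text \<open>Evaluates the limit of \<open>n\<close> equal contributions, each an increment of
  \<open>f\<close> over a step \<open>c / n\<close>.\<close>

lemma DERIV_imp_LIMSEQ_scaled_difference:
  fixes f :: "real \<Rightarrow> real"
  assumes f: "DERIV f x :> D" and "c \<noteq> 0"
  shows "(\<lambda>n. real n * (f (x + c / real n) - f x)) \<longlonglongrightarrow> c * D"
proof -
  have "filterlim (\<lambda>n. c / real n) (at 0) sequentially"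
    unfolding filterlim_at using \<open>c \<noteq> 0\<close>
    by (auto simp: eventually_sequentially intro!: exI[of _ 1] tendsto_divide_0[OF tendsto_const]
        filterlim_at_top_imp_at_infinity filterlim_real_sequentially)
  with f[unfolded DERIV_def]
  have "(\<lambda>n. (f (x + c / real n) - f x) / (c / real n)) \<longlonglongrightarrow> D"
    by (rule filterlim_compose)
  from tendsto_mult[OF tendsto_const[of c] this] show ?thesis
    by (rule Lim_transform_eventually)
       (use \<open>c \<noteq> 0\<close> in \<open>auto simp: eventually_sequentially intro!: exI[of _ 1]\<close>)
qed

context brownian_motion
begin

text \<open>The value at time 1 of the Pitman transform of \<open>U\<close>, twice the running
  maximum minus the path.\<close>

definition R :: "'a \<Rightarrow> real" where
  "R \<omega> = 2 * (SUP t\<in>{0..1}. U t \<omega>) - U 1 \<omega>"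

lemma bdd_above_U: "\<omega> \<in> space M \<Longrightarrow> bdd_above ((\<lambda>t. U t \<omega>) ` {0..1})"
  by (intro bounded_imp_bdd_above compact_imp_bounded compact_continuous_image continuous_on_U) auto

lemma less_SUP_U_iff: "\<omega> \<in> space M \<Longrightarrow> m < (SUP t\<in>{0..1}. U t \<omega>) \<longleftrightarrow> (\<exists>t\<in>{0..1}. m < U t \<omega>)"
  by (intro less_cSUP_iff bdd_above_U) auto

lemma R_measurable [measurable]: "R \<in> borel_measurable M"
proof -
  have [measurable]: "(\<lambda>\<omega>. SUP t\<in>{0..1}. U t \<omega>) \<in> borel_measurable M"
    unfolding borel_measurable_iff_greater
    using sets_U_exceeds by (auto simp: less_SUP_U_iff cong: conj_cong)
  show ?thesis
    unfolding R_def[abs_def] by measurable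
qed

text \<open>Turns \<open>r < R\<close> into passage through a level depending only on
  \<open>U 1\<close>. On a thin slab of values of \<open>U 1\<close> this level is nearly constant,
  which brings it within reach of the reflection principle.\<close>

lemma less_R_iff: "\<omega> \<in> space M \<Longrightarrow> r < R \<omega> \<longleftrightarrow> (\<exists>t\<in>{0..1}. (r + U 1 \<omega>) / 2 < U t \<omega>)"
  by (subst less_SUP_U_iff[symmetric]) (auto simp: R_def)

text \<open>The supremum is at least \<open>U 0 = 0\<close> and at least \<open>U 1\<close>.\<close>

lemma abs_U_le_R: "\<omega> \<in> space M \<Longrightarrow> \<bar>U 1 \<omega>\<bar> \<le> R \<omega>"
  using cSUP_upper[OF _ bdd_above_U, of 0 \<omega>] cSUP_upper[OF _ bdd_above_U, of 1 \<omega>]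
  by (auto simp: R_def)

lemma prob_U_atLeast:
  assumes "A \<in> sets borel"
  shows "prob {\<omega> \<in> space M. c \<le> U 1 \<omega> \<and> V \<omega> \<in> A} = (1 - std_normal_cdf c) * measure std_normal_distribution A"
  using prob_U_V[of "{c..}" A] assms by (simp add: measure_std_normal_distribution_atLeast)

text \<open>The difference of the reflection identities at \<open>y'\<close> and \<open>y\<close>:
  the slab for \<open>U 1\<close> is mirrored at \<open>m\<close>.\<close>

lemma prob_U_exceeds_slab:
  assumes m: "0 \<le> m" "y \<le> y'" "y' \<le> m" and A[measurable]: "A \<in> sets borel"
  shows "prob {\<omega> \<in> space M. (\<exists>t\<in>{0..1}. m < U t \<omega>) \<and> y < U 1 \<omega> \<and> U 1 \<omega> \<le> y' \<and> V \<omega> \<in> A} =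
    (std_normal_cdf (2 * m - y) - std_normal_cdf (2 * m - y')) * measure std_normal_distribution A"
    (is "prob ?Q = _")
proof -
  let ?E = "\<lambda>y. {\<omega> \<in> space M. (\<exists>t\<in>{0..1}. m < U t \<omega>) \<and> U 1 \<omega> \<le> y \<and> V \<omega> \<in> A}"
  have E: "prob (?E z) = (1 - std_normal_cdf (2 * m - z)) * measure std_normal_distribution A" if "z \<le> m" for z
    using prob_U_exceeds_reflected[OF m(1) that A] prob_U_atLeast[OF A] by simp
  have "prob (?E y') = prob (?E y \<union> ?Q)"
    using m by (intro arg_cong[where f=prob]) auto
  also have "\<dots> = prob (?E y) + prob ?Q"
    by (intro finite_measure_Union) (measurable, auto)
  finally show ?thesis
    using E[of y] E[of y'] m by (simp add: algebra_simps)
qed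

text \<open>The interval from \<open>- r\<close> to \<open>r\<close> is cut into \<open>K\<close>
  slabs of width \<open>2 * r / K\<close>. The bounds for one slab do not depend on its position, so
  \<open>K\<close> times each bound encloses the total, and both products converge to a multiple of
  the derivative of \<open>std_normal_cdf\<close> at \<open>r\<close>.\<close>

lemma prob_R_slabs:
  assumes r: "0 < r" and A[measurable]: "A \<in> sets borel"
  shows "prob {\<omega> \<in> space M. r < R \<omega> \<and> - r < U 1 \<omega> \<and> U 1 \<omega> \<le> r \<and> V \<omega> \<in> A} =
    2 * r * std_normal_density r * measure std_normal_distribution A"
    (is "prob ?G = _")
proof -
  define F where "F y = prob {\<omega> \<in> space M. r < R \<omega> \<and> - r < U 1 \<omega> \<and> U 1 \<omega> \<le> y \<and> V \<omega> \<in> A}" for y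
  let ?Q = "\<lambda>y y'. {\<omega> \<in> space M. r < R \<omega> \<and> y < U 1 \<omega> \<and> U 1 \<omega> \<le> y' \<and> V \<omega> \<in> A}"
  let ?A = "measure std_normal_distribution A"
  have F_diff: "F y' - F y = prob (?Q y y')" if "- r \<le> y" "y \<le> y'" for y y'
  proof -
    have "F y' = prob ({\<omega> \<in> space M. r < R \<omega> \<and> - r < U 1 \<omega> \<and> U 1 \<omega> \<le> y \<and> V \<omega> \<in> A} \<union> ?Q y y')"
      unfolding F_def using that by (intro arg_cong[where f=prob]) auto
    also have "\<dots> = F y + prob (?Q y y')"
      unfolding F_def by (intro finite_measure_Union) (measurable, auto)
    finally show ?thesis by simp
  qed
  have F0: "F (- r) = 0"
    unfolding F_def by (subst measure_empty[symmetric, of M], intro arg_cong[where f=prob]) auto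
  \<comment> \<open>For the upper bound the reflection level is \<open>(r + y) / 2\<close>, which
    must not lie below the slab's top: \<open>y + 2 * d \<le> r\<close>. The topmost slab violates
    this and is bounded by dropping \<open>r < R\<close> instead.\<close>
  have slab: "(std_normal_cdf (r + d) - std_normal_cdf r) * ?A \<le> prob (?Q y (y + d))"
      "prob (?Q y (y + d)) \<le> (std_normal_cdf r - std_normal_cdf (r - d)) * ?A"
    if y: "- r \<le> y" "y + d \<le> r" "0 < d" "y + d = r \<or> y + 2 * d \<le> r" for y d
  proof -
    let ?H = "\<lambda>m. {\<omega> \<in> space M. (\<exists>t\<in>{0..1}. m < U t \<omega>) \<and> y < U 1 \<omega> \<and> U 1 \<omega> \<le> y + d \<and> V \<omega> \<in> A}"
    have "2 * ((r + y + d) / 2) - y = r + d" "2 * ((r + y + d) / 2) - (y + d) = r"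
      by (simp_all only: field_simps) simp_all
    then have "(std_normal_cdf (r + d) - std_normal_cdf r) * ?A = prob (?H ((r + y + d) / 2))"
      using y prob_U_exceeds_slab[of "(r + y + d) / 2" y "y + d" A] by (simp only: A)
    also have "\<dots> \<le> prob (?Q y (y + d))"
      by (rule finite_measure_mono, force simp: less_R_iff, measurable)
    finally show "(std_normal_cdf (r + d) - std_normal_cdf r) * ?A \<le> prob (?Q y (y + d))" .
    show "prob (?Q y (y + d)) \<le> (std_normal_cdf r - std_normal_cdf (r - d)) * ?A"
      using y(4)
    proof
      assume yd: "y + d = r"
      have "prob (?Q y (y + d)) \<le> prob {\<omega> \<in> space M. U 1 \<omega> \<in> {r - d<..r} \<and> V \<omega> \<in> A}"
        using yd by (intro finite_measure_mono, measurable) auto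
      also have "\<dots> = (std_normal_cdf r - std_normal_cdf (r - d)) * ?A"
        using y by (subst prob_U_V) (auto simp: measure_std_normal_distribution_greaterThanAtMost)
      finally show ?thesis .
    next
      assume yd: "y + 2 * d \<le> r"
      have "prob (?Q y (y + d)) \<le> prob (?H ((r + y) / 2))"
        by (rule finite_measure_mono, force simp: less_R_iff, measurable)
      also have "\<dots> = (std_normal_cdf r - std_normal_cdf (r - d)) * ?A"
      proof -
        have "2 * ((r + y) / 2) - y = r" "2 * ((r + y) / 2) - (y + d) = r - d"
          by (simp_all only: field_simps) simp_all
        then show ?thesis
          using y yd prob_U_exceeds_slab[of "(r + y) / 2" y "y + d" A] by (simp only: A)
      qed
      finally show ?thesis .
    qed
  qed
  \<comment> \<open>On a slab of width \<open>d\<close> starting at \<open>y\<close>, the condition \<open>r < R\<close> lies between the passage through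
    \<open>(r + y + d) / 2\<close> and that through \<open>(r + y) / 2\<close>; both reflect the slab to an interval of length \<open>d\<close>
    with endpoint \<open>r\<close>. The topmost slab is such an interval already.\<close>
  have bounds: "real K * (std_normal_cdf (r + 2 * r / real K) - std_normal_cdf r) * ?A \<le> prob ?G \<and>
      prob ?G \<le> real K * (std_normal_cdf r - std_normal_cdf (r - 2 * r / real K)) * ?A" if "0 < K" for K :: nat
  proof -
    define d where "d = 2 * r / real K"
    define y where "y j = - r + real j * d" for j :: nat
    have d: "0 < d" "real K * d = 2 * r"
      using that r by (auto simp: d_def)
    have yK: "y K = r" "y 0 = - r" and y_Suc: "y (Suc j) = y j + d" for j
      using d by (auto simp: y_def algebra_simps)
    have le: "y j \<le> r" if "j \<le> K" for j
      using that d mult_right_mono[of "real j" "real K" d] by (simp add: y_def)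
    have conds: "- r \<le> y j" "y j + d \<le> r" "y j + d = r \<or> y j + 2 * d \<le> r" if "j < K" for j
    proof -
      show "- r \<le> y j" using d by (simp add: y_def)
      show "y j + d \<le> r" using le[of "Suc j"] that by (simp add: y_Suc)
      show "y j + d = r \<or> y j + 2 * d \<le> r"
      proof (cases "Suc j = K")
        case True
        then show ?thesis using yK(1) y_Suc[of j] by simp
      next
        case False
        then show ?thesis using le[of "Suc (Suc j)"] that by (simp add: y_Suc)
      qed
    qed
    have "prob ?G = F (y K) - F (y 0)"
      by (simp add: F0 yK) (simp add: F_def)
    also have "\<dots> = (\<Sum>j<K. F (y (Suc j)) - F (y j))"
      by (rule sum_lessThan_telescope[symmetric])
    also have "\<dots> = (\<Sum>j<K. prob (?Q (y j) (y j + d)))"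
      using conds d by (intro sum.cong refl) (auto simp: y_Suc intro!: F_diff)
    finally have eq: "prob ?G = (\<Sum>j<K. prob (?Q (y j) (y j + d)))" .
    have "(\<Sum>j<K. (std_normal_cdf (r + d) - std_normal_cdf r) * ?A) \<le> prob ?G"
      unfolding eq using conds d by (intro sum_mono slab) auto
    moreover have "prob ?G \<le> (\<Sum>j<K. (std_normal_cdf r - std_normal_cdf (r - d)) * ?A)"
      unfolding eq using conds d by (intro sum_mono slab) auto
    ultimately show ?thesis
      by (simp add: d_def mult.assoc)
  qed
  have "(\<lambda>K. real K * (std_normal_cdf (r + 2 * r / real K) - std_normal_cdf r) * ?A)
      \<longlonglongrightarrow> 2 * r * std_normal_density r * ?A"
    using r by (intro tendsto_mult tendsto_const DERIV_imp_LIMSEQ_scaled_difference[OF DERIV_std_normal_cdf]) auto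
  then have "2 * r * std_normal_density r * ?A \<le> prob ?G"
    by (rule tendsto_upperbound)
       (auto simp: bounds eventually_sequentially intro!: exI[of _ 1])
  \<comment> \<open>The upper bound is a difference quotient from the left, hence the step constant
    \<open>- 2 * r\<close> and the outer sign.\<close>
  moreover have "(\<lambda>K. - (real K * (std_normal_cdf (r + (- 2 * r) / real K) - std_normal_cdf r)) * ?A)
      \<longlonglongrightarrow> - ((- 2 * r) * std_normal_density r) * ?A"
    using r by (intro tendsto_mult tendsto_minus tendsto_const DERIV_imp_LIMSEQ_scaled_difference[OF DERIV_std_normal_cdf]) auto
  then have "(\<lambda>K. real K * (std_normal_cdf r - std_normal_cdf (r - 2 * r / real K)) * ?A)
      \<longlonglongrightarrow> 2 * r * std_normal_density r * ?A"
    by (simp add: algebra_simps)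
  then have "prob ?G \<le> 2 * r * std_normal_density r * ?A"
    by (rule tendsto_lowerbound)
       (auto simp: bounds eventually_sequentially intro!: exI[of _ 1])
  ultimately show ?thesis by simp
qed

text \<open>Because \<open>R\<close> dominates the absolute value of \<open>U 1\<close>, the two
  tails of \<open>U 1\<close> beyond \<open>r\<close> and \<open>- r\<close> belong to the event up
  to null sets, and the previous lemma covers the middle. The factor depending on \<open>A\<close>
  splits off, which later gives independence of \<open>V\<close>.\<close>

lemma prob_less_R:
  assumes r: "0 \<le> r" and A[measurable]: "A \<in> sets borel"
  shows "prob {\<omega> \<in> space M. r < R \<omega> \<and> V \<omega> \<in> A} =
    (2 * (1 - std_normal_cdf r) + 2 * r * std_normal_density r) * measure std_normal_distribution A"
proof -
  let ?A = "measure std_normal_distribution A"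
  let ?G = "{\<omega> \<in> space M. r < R \<omega> \<and> - r < U 1 \<omega> \<and> U 1 \<omega> \<le> r \<and> V \<omega> \<in> A}"
  let ?H = "{\<omega> \<in> space M. U 1 \<omega> \<in> {r..} \<and> V \<omega> \<in> A}"
  let ?L = "{\<omega> \<in> space M. U 1 \<omega> \<in> {..-r} \<and> V \<omega> \<in> A}"
  \<comment> \<open>The boundary values \<open>r\<close> and \<open>- r\<close> of
    \<open>U 1\<close> are null, which permits closed tails and their overlaps with the middle part
    or, for \<open>r = 0\<close>, with each other.\<close>
  have null: "AE \<omega> in M. U 1 \<omega> \<noteq> c" for c
  proof -
    have "prob {\<omega> \<in> space M. U 1 \<omega> = c} = 0"
      using prob_U_V[of "{c}" UNIV] by simp
    then show ?thesis
      by (intro AE_I[of _ _ "{\<omega> \<in> space M. U 1 \<omega> = c}"]) (auto simp: emeasure_eq_measure)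
  qed
  have "prob {\<omega> \<in> space M. r < R \<omega> \<and> V \<omega> \<in> A} = prob (?G \<union> (?H \<union> ?L))"
  proof (rule finite_measure_eq_AE)
    show "AE \<omega> in M. (\<omega> \<in> {\<omega> \<in> space M. r < R \<omega> \<and> V \<omega> \<in> A}) = (\<omega> \<in> ?G \<union> (?H \<union> ?L))"
      using null[of r] null[of "- r"] AE_space
    proof eventually_elim
      case (elim \<omega>)
      with abs_U_le_R[of \<omega>] show ?case by auto
    qed
  qed measurable
  also have "\<dots> = prob ?G + prob (?H \<union> ?L)"
  proof (rule measure_Un_AE)
    show "AE \<omega> in M. \<omega> \<notin> ?G \<or> \<omega> \<notin> ?H \<union> ?L"
      using null[of r] by eventually_elim auto
  qed (auto simp: fmeasurable_eq_sets)
  also have "prob (?H \<union> ?L) = prob ?H + prob ?L"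
  proof (rule measure_Un_AE)
    show "AE \<omega> in M. \<omega> \<notin> ?H \<or> \<omega> \<notin> ?L"
      using null[of r] by eventually_elim (use r in auto)
  qed (auto simp: fmeasurable_eq_sets)
  also have "prob ?H = (1 - std_normal_cdf r) * ?A"
    by (subst prob_U_V) (auto simp: measure_std_normal_distribution_atLeast)
  also have "prob ?L = (1 - std_normal_cdf r) * ?A"
    by (subst prob_U_V) (auto simp: measure_std_normal_distribution_atMost std_normal_cdf_minus)
  also have "prob ?G = 2 * r * std_normal_density r * ?A"
  proof (cases "r = 0")
    case True
    then have "?G = {}" by auto
    then show ?thesis unfolding \<open>?G = {}\<close> using True by simp
  next
    case False
    with r prob_R_slabs[OF _ A, of r] show ?thesis by simp
  qed
  finally show ?thesis
    by (simp add: algebra_simps)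
qed

lemma prob_V: "A \<in> sets borel \<Longrightarrow> prob {\<omega> \<in> space M. V \<omega> \<in> A} = measure std_normal_distribution A"
  using prob_U_V[of UNIV A] std_normal.prob_space by simp

lemma distributed_V: "distributed M lborel V std_normal_density"
proof -
  have "distr M lborel V = std_normal_distribution"
  proof (rule measure_eqI)
    fix A assume "A \<in> sets (distr M lborel V)"
    then have "A \<in> sets borel" by simp
    with prob_V[OF this] show "emeasure (distr M lborel V) A = emeasure std_normal_distribution A"
      by (simp add: emeasure_distr emeasure_eq_measure std_normal.emeasure_eq_measure vimage_def Int_def conj_commute)
  qed simp
  then show ?thesis
    by (auto simp: distributed_def)
qed

lemma distributed_R:
  "distributed M lborel R (\<lambda>x. ennreal (2 * x\<^sup>2 * std_normal_density x * indicator {0..} x))"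
proof -
  \<comment> \<open>For \<open>a \<ge> 0\<close> this is one minus the tail from
    \<open>prob_less_R\<close>; up to a constant it is an antiderivative of the Maxwell
    density.\<close>
  let ?g = "\<lambda>a. if a < 0 then 0 else 2 * std_normal_cdf a - 1 - 2 * a * std_normal_density a"
  show ?thesis
  proof (rule distributedI_borel_atMost[where g="?g"])
    fix a :: real
    have half: "std_normal_cdf 0 = 1 / 2"
      using std_normal_cdf_minus[of 0] by simp
    show "(\<integral>\<^sup>+x. ennreal (2 * x\<^sup>2 * std_normal_density x * indicator {0..} x * indicator {..a} x) \<partial>lborel) = ennreal (?g a)"
    proof (cases "a < 0")
      case True
      then have "(\<integral>\<^sup>+x. ennreal (2 * x\<^sup>2 * std_normal_density x * indicator {0..} x * indicator {..a} x) \<partial>lborel) = (\<integral>\<^sup>+(x::real). 0 \<partial>lborel)"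
        by (intro nn_integral_cong) (auto split: split_indicator)
      with True show ?thesis by simp
    next
      case False
      let ?F = "\<lambda>x. 2 * std_normal_cdf x - 2 * x * std_normal_density x"
      have "(\<integral>\<^sup>+x. ennreal (2 * x\<^sup>2 * std_normal_density x * indicator {0..} x * indicator {..a} x) \<partial>lborel) =
          (\<integral>\<^sup>+x. ennreal (2 * x\<^sup>2 * std_normal_density x) * indicator {0..a} x \<partial>lborel)"
        by (intro nn_integral_cong) (auto split: split_indicator)
      also have "\<dots> = ennreal (?F a - ?F 0)"
      proof (rule nn_integral_FTC_Icc)
        fix x show "DERIV ?F x :> 2 * x\<^sup>2 * std_normal_density x"
          by (auto intro!: derivative_eq_intros DERIV_std_normal_cdf DERIV_std_normal_density
              simp: power2_eq_square algebra_simps)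
      qed (use False in auto)
      finally show ?thesis using False half by (simp add: algebra_simps)
    qed
    show "emeasure M {\<omega> \<in> space M. R \<omega> \<le> a} = ennreal (?g a)"
    proof (cases "a < 0")
      case True
      then have "{\<omega> \<in> space M. R \<omega> \<le> a} = {}"
        using abs_U_le_R by (force intro: abs_ge_zero)
      with True show ?thesis by (simp only: emeasure_empty) simp
    next
      case False
      have "prob {\<omega> \<in> space M. R \<omega> \<le> a} = 1 - prob {\<omega> \<in> space M. \<not> R \<omega> \<le> a}"
        by (subst prob_neg) auto
      also have "prob {\<omega> \<in> space M. \<not> R \<omega> \<le> a} = 2 * (1 - std_normal_cdf a) + 2 * a * std_normal_density a"
        using prob_less_R[of a UNIV] False std_normal.prob_space by (simp add: not_le)
      finally have "prob {\<omega> \<in> space M. R \<omega> \<le> a} = 2 * std_normal_cdf a - 1 - 2 * a * std_normal_density a"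
        by simp
      then show ?thesis
        using False by (simp add: emeasure_eq_measure)
    qed
  qed auto
qed

text \<open>\<open>prob_less_R\<close> gives the product formula for half-lines on the side of
  \<open>R\<close> and all Borel sets on the side of \<open>V\<close>. Both families are stable
  under intersection, so independence extends to the generated sigma-algebras.\<close>

lemma indep_V_R: "indep_var borel V borel R"
proof -
  let ?V = "{V -` A \<inter> space M |A. A \<in> sets borel}"
  let ?R = "{R -` A \<inter> space M |A. A \<in> range greaterThan}"
  have "indep_set ?V ?R"
  proof (rule indep_setI)
    fix a b assume "a \<in> ?V" "b \<in> ?R"
    then obtain A r where A: "A \<in> sets borel" and ab: "a = V -` A \<inter> space M" "b = R -` {r<..} \<inter> space M"
      by auto
    have a: "a = {\<omega> \<in> space M. V \<omega> \<in> A}" and b: "b = {\<omega> \<in> space M. r < R \<omega> \<and> V \<omega> \<in> UNIV}"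
      and i: "a \<inter> b = {\<omega> \<in> space M. r < R \<omega> \<and> V \<omega> \<in> A}"
      by (auto simp: ab)
    show "prob (a \<inter> b) = prob a * prob b"
    proof (cases "0 \<le> r")
      case True
      show ?thesis
        unfolding i unfolding a b
        using True A prob_less_R[of r A] prob_less_R[of r UNIV] std_normal.prob_space by (simp add: prob_V)
    next
      case False
      then have "b = space M"
        using abs_U_le_R by (force simp: ab)
      then show ?thesis
        by (simp add: prob_space ab)
    qed
  qed (auto intro: measurable_sets[OF V_measurable] measurable_sets[OF R_measurable])
  moreover have "Int_stable ?V"
    unfolding Int_stable_def by (auto, metis sets.Int vimage_Int Int_assoc Int_left_commute Int_absorb)
  moreover have "Int_stable ?R"
  proof (rule Int_stableI)
    fix a b assume "a \<in> ?R" "b \<in> ?R"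
    then obtain r s where "a = R -` {r<..} \<inter> space M" "b = R -` {s<..} \<inter> space M"
      by auto
    then have "a \<inter> b = R -` {max r s<..} \<inter> space M"
      by auto
    then show "a \<inter> b \<in> ?R" by blast
  qed
  ultimately have "indep_set (sigma_sets (space M) ?V) (sigma_sets (space M) ?R)"
    by (rule indep_set_sigma_sets)
  moreover have "{R -` A \<inter> space M |A. A \<in> sets borel} = sigma_sets (space M) ?R"
    unfolding borel_Ioi using sigma_sets_vimage_commute[of R "space M" UNIV "range greaterThan"]
    by (simp add: sets_measure_of)
  moreover have "sigma_sets (space M) (sigma_sets (space M) ?R) = sigma_sets (space M) ?R"
    by (rule sigma_sets_sigma_sets_eq) auto
  ultimately show ?thesis
    unfolding indep_var_eq by simp
qed

end

section \<open>Convolution of the normal and Maxwell densities\<close>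

lemma DERIV_square_moment_antiderivative:
  "DERIV (\<lambda>u. (1 + b\<^sup>2) * std_normal_cdf u - u * std_normal_density u - 2 * b * std_normal_density u) u
    :> (u + b)\<^sup>2 * std_normal_density u"
  by (auto intro!: derivative_eq_intros DERIV_std_normal_cdf DERIV_std_normal_density
      simp: power2_eq_square algebra_simps)

lemma square_moment_antiderivative_at_top:
  "((\<lambda>u. (1 + b\<^sup>2) * std_normal_cdf u - u * std_normal_density u - 2 * b * std_normal_density u) \<longlongrightarrow> 1 + b\<^sup>2) at_top"
  using tendsto_diff[OF tendsto_diff[OF tendsto_mult[OF tendsto_const[of "1 + b\<^sup>2"] std_normal_cdf_at_top]
    times_std_normal_density_at_top] tendsto_mult[OF tendsto_const[of "2 * b"] std_normal_density_at_top]]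
  by simp

text \<open>The expression is the integral of \<open>(u + b)^2 * std_normal_density u\<close> over
  \<open>u \<ge> - b\<close>, that is, the limit of the antiderivative minus its value at
  \<open>- b\<close>.\<close>

lemma square_moment_nonneg: "0 \<le> (1 + b\<^sup>2) * std_normal_cdf b + b * std_normal_density b"
proof -
  let ?F = "\<lambda>u. (1 + b\<^sup>2) * std_normal_cdf u - u * std_normal_density u - 2 * b * std_normal_density u"
  have "?F (- b) \<le> ?F u" if "- b \<le> u" for u
    using that by (rule DERIV_nonneg_imp_nondecreasing) (use DERIV_square_moment_antiderivative in fastforce)
  then have "?F (- b) \<le> 1 + b\<^sup>2"
    by (intro tendsto_lowerbound[OF square_moment_antiderivative_at_top])
       (auto simp: eventually_at_top_linorder intro!: exI[of _ "- b"])
  then show ?thesis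
    by (simp add: std_normal_cdf_minus algebra_simps)
qed

text \<open>Completing the square gives \<open>(z - y)^2 + y^2 = b^2 + (sqrt 2 * y - b)^2\<close>,
  so a factor depending only on \<open>b\<close> splits off. With \<open>u = sqrt 2 * y - b\<close>
  the rest is the square moment over \<open>u \<ge> - b\<close>.\<close>

lemma std_normal_maxwell_convolution:
  fixes z :: real
  defines "b \<equiv> z / sqrt 2"
  shows "(\<integral>\<^sup>+y. ennreal (std_normal_density (z - y)) * ennreal (2 * y\<^sup>2 * std_normal_density y * indicator {0..} y) \<partial>lborel) =
    ennreal (std_normal_density b * ((1 + b\<^sup>2) * std_normal_cdf b + b * std_normal_density b) / sqrt 2)"
proof -
  let ?F = "\<lambda>u. (1 + b\<^sup>2) * std_normal_cdf u - u * std_normal_density u - 2 * b * std_normal_density u"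
  let ?H = "\<lambda>y. std_normal_density b / sqrt 2 * ?F (sqrt 2 * y - b)"
  let ?f = "\<lambda>y. std_normal_density b * ((sqrt 2 * y)\<^sup>2 * std_normal_density (sqrt 2 * y - b))"
  have "std_normal_density (z - y) * (2 * y\<^sup>2 * std_normal_density y) = ?f y" for y
  proof -
    have z: "z = sqrt 2 * b" by (simp add: b_def)
    have e: "(z - y)\<^sup>2 + y\<^sup>2 = b\<^sup>2 + (sqrt 2 * y - b)\<^sup>2"
      unfolding z by (simp add: power2_eq_square algebra_simps)
    have "std_normal_density (z - y) * std_normal_density y = std_normal_density b * std_normal_density (sqrt 2 * y - b)"
      unfolding std_normal_density_times e ..
    then show ?thesis
      by (simp add: power_mult_distrib)
  qed
  then have "(\<integral>\<^sup>+y. ennreal (std_normal_density (z - y)) * ennreal (2 * y\<^sup>2 * std_normal_density y * indicator {0..} y) \<partial>lborel) =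
      (\<integral>\<^sup>+y. ennreal (?f y) * indicator {0..} y \<partial>lborel)"
    by (intro nn_integral_cong) (auto split: split_indicator simp flip: ennreal_mult)
  also have "\<dots> = ennreal (std_normal_density b / sqrt 2 * (1 + b\<^sup>2) - ?H 0)"
  proof (rule nn_integral_FTC_atLeast[where F="?H"])
    fix y :: real
    have "DERIV (\<lambda>y. ?F (sqrt 2 * y - b)) y :> ((sqrt 2 * y - b) + b)\<^sup>2 * std_normal_density (sqrt 2 * y - b) * sqrt 2"
      by (rule DERIV_chain2[OF DERIV_square_moment_antiderivative]) (auto intro!: derivative_eq_intros)
    from DERIV_cmult[OF this, of "std_normal_density b / sqrt 2"]
    show "DERIV ?H y :> ?f y"
      by (rule DERIV_cong) (simp add: field_simps)
  next
    have "filterlim (\<lambda>y::real. sqrt 2 * y - b) at_top at_top"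
      by real_asymp
    from filterlim_compose[OF square_moment_antiderivative_at_top this]
    show "(?H \<longlongrightarrow> std_normal_density b / sqrt 2 * (1 + b\<^sup>2)) at_top"
      by (intro tendsto_mult tendsto_const)
  qed auto
  also have "std_normal_density b / sqrt 2 * (1 + b\<^sup>2) - ?H 0 =
      std_normal_density b * ((1 + b\<^sup>2) * std_normal_cdf b + b * std_normal_density b) / sqrt 2"
    by (simp add: std_normal_cdf_minus algebra_simps add_divide_distrib diff_divide_distrib)
  finally show ?thesis .
qed

section \<open>The distribution of the maximum of the Slepian process\<close>

theorem theorem3p1:
  fixes M :: "'a measure" and B :: "real \<Rightarrow> 'a \<Rightarrow> real" and a :: real
  assumes "std_brownian_motion M B"
  shows "measure M {\<omega> \<in> space M. \<forall>t\<in>{0..1}. B (t + 1) \<omega> - B t \<omega> \<le> a}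
         = (std_normal_cdf a)\<^sup>2 - a * std_normal_density a * std_normal_cdf a
           - (std_normal_density a)\<^sup>2"
proof -
  interpret prob_space M
    using assms by (simp add: std_brownian_motion_def)
  interpret brownian_motion M B
    by standard fact
  let ?h = "\<lambda>z. std_normal_density (z / sqrt 2) *
    ((1 + (z / sqrt 2)\<^sup>2) * std_normal_cdf (z / sqrt 2) + z / sqrt 2 * std_normal_density (z / sqrt 2)) / sqrt 2"
  \<comment> \<open>The claimed distribution function. The density \<open>?h\<close> of
    \<open>V + R\<close> is the derivative of \<open>?G (z / sqrt 2)\<close>, so its tail integral
    follows from the limit 1 at infinity.\<close>
  let ?G = "\<lambda>x. (std_normal_cdf x)\<^sup>2 - x * std_normal_density x * std_normal_cdf x - (std_normal_density x)\<^sup>2"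
  define c where "c = sqrt 2 * a"
  have event: "(\<forall>t\<in>{0..1}. B (t + 1) \<omega> - B t \<omega> \<le> a) \<longleftrightarrow> \<not> c < V \<omega> + R \<omega>" if "\<omega> \<in> space M" for \<omega>
  proof -
    \<comment> \<open>The threshold on the right is the level in \<open>less_R_iff\<close> for
      \<open>r = c - V\<close>, so quantifying over \<open>t\<close> yields
      \<open>R\<close>.\<close>
    have "B (t + 1) \<omega> - B t \<omega> \<le> a \<longleftrightarrow> \<not> ((c - V \<omega>) + U 1 \<omega>) / 2 < U t \<omega>" for t
    proof -
      have "2 * U t \<omega> - U 1 \<omega> + V \<omega> = 2 * (B (t + 1) \<omega> - B t \<omega>) / sqrt 2"
        by (simp add: U_def V_def add.commute diff_divide_distrib[symmetric] add_divide_distrib[symmetric] algebra_simps)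
      also have "\<dots> = sqrt 2 * (B (t + 1) \<omega> - B t \<omega>)"
        by (simp add: field_simps)
      finally have "B (t + 1) \<omega> - B t \<omega> \<le> a \<longleftrightarrow> 2 * U t \<omega> - U 1 \<omega> + V \<omega> \<le> c"
        by (simp add: c_def)
      then show ?thesis by auto
    qed
    moreover have "c < V \<omega> + R \<omega> \<longleftrightarrow> c - V \<omega> < R \<omega>"
      by auto
    ultimately show ?thesis
      by (simp only: less_R_iff[OF that]) blast
  qed
  have [measurable]: "std_normal_cdf \<in> borel_measurable borel"
    by (intro borel_measurable_continuous_onI continuous_at_imp_continuous_on ballI
        DERIV_isCont[OF DERIV_std_normal_cdf])
  have G: "DERIV ?G x :> std_normal_density x * ((1 + x\<^sup>2) * std_normal_cdf x + x * std_normal_density x)" for x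
    by (auto intro!: derivative_eq_intros DERIV_std_normal_cdf DERIV_std_normal_density
        simp: power2_eq_square algebra_simps)
  have G_lim: "(?G \<longlongrightarrow> 1) at_top"
    using tendsto_diff[OF tendsto_diff[OF tendsto_power[OF std_normal_cdf_at_top, of 2]
      tendsto_mult[OF times_std_normal_density_at_top std_normal_cdf_at_top]]
      tendsto_power[OF std_normal_density_at_top, of 2]] by simp
  have sum: "distributed M lborel (\<lambda>\<omega>. V \<omega> + R \<omega>) (\<lambda>z. ennreal (?h z))"
    using distributed_convolution[OF indep_V_R distributed_V distributed_R]
    by (simp only: std_normal_maxwell_convolution)
  have "emeasure M ((\<lambda>\<omega>. V \<omega> + R \<omega>) -` {c<..} \<inter> space M) = (\<integral>\<^sup>+z. ennreal (?h z) * indicator {c<..} z \<partial>lborel)"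
    using sum by (rule distributed_emeasure) simp
  also have "\<dots> = (\<integral>\<^sup>+z. ennreal (?h z) * indicator {c..} z \<partial>lborel)"
    using AE_lborel_singleton[of c]
    by (intro nn_integral_cong_AE) (auto elim!: eventually_mono split: split_indicator)
  also have "\<dots> = ennreal (1 - ?G (c / sqrt 2))"
  proof (rule nn_integral_FTC_atLeast[where F="\<lambda>z. ?G (z / sqrt 2)"])
    fix z :: real
    have "DERIV (\<lambda>z. ?G (z / sqrt 2)) z :> std_normal_density (z / sqrt 2) *
      ((1 + (z / sqrt 2)\<^sup>2) * std_normal_cdf (z / sqrt 2) + z / sqrt 2 * std_normal_density (z / sqrt 2)) * (1 / sqrt 2)"
      by (rule DERIV_chain2[OF G DERIV_cdivide[OF DERIV_ident]])
    then show "DERIV (\<lambda>z. ?G (z / sqrt 2)) z :> ?h z"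
      by (rule DERIV_cong) (simp only: times_divide_eq_right mult_1_right)
    show "0 \<le> ?h z"
      using square_moment_nonneg[of "z / sqrt 2"] by simp
  next
    have "filterlim (\<lambda>z::real. z / sqrt 2) at_top at_top"
      by real_asymp
    from filterlim_compose[OF G_lim this]
    show "((\<lambda>z. ?G (z / sqrt 2)) \<longlongrightarrow> 1) at_top" .
  qed measurable
  finally have em: "emeasure M {\<omega> \<in> space M. c < V \<omega> + R \<omega>} = ennreal (1 - ?G a)"
    by (simp add: c_def vimage_def Int_def conj_commute)
  \<comment> \<open>Since \<open>ennreal\<close> sends negative numbers to 0, the value
    \<open>1 - ?G a\<close> can be read off only once it is known to be nonnegative; monotonicity of
    \<open>?G\<close> and its limit 1 provide this.\<close>
  have "?G a \<le> ?G x" if "a \<le> x" for x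
    using that by (rule DERIV_nonneg_imp_nondecreasing)
      (use G square_moment_nonneg in \<open>blast intro: mult_nonneg_nonneg normal_density_nonneg\<close>)
  then have "?G a \<le> 1"
    by (intro tendsto_lowerbound[OF G_lim])
       (auto simp: eventually_at_top_linorder intro!: exI[of _ a])
  with em have "prob {\<omega> \<in> space M. c < V \<omega> + R \<omega>} = 1 - ?G a"
    by (simp add: measure_def)
  then have "prob {\<omega> \<in> space M. \<not> c < V \<omega> + R \<omega>} = ?G a"
    by (subst prob_neg) auto
  moreover have "{\<omega> \<in> space M. \<forall>t\<in>{0..1}. B (t + 1) \<omega> - B t \<omega> \<le> a} = {\<omega> \<in> space M. \<not> c < V \<omega> + R \<omega>}"
    using event by blast
  ultimately show ?thesis
    by simp
qed

end
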